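(* Let $(N=\Gamma\backslash G, I, J, K)$ be a hypercomplex nilmanifold whose Obata connection is flat, and let $\mathfrak{g}=\operatorname{Lie}(G)$ be the corresponding Lie algebra with the induced hypercomplex structure $I,J,K$. Then $\mathfrak{g}$ is $\mathbb{H}$-solvable.
   Context: A nilmanifold is a compact quotient $N=\Gamma\backslash G$, where $G$ is a connected simply connected nilpotent (real) Lie group and $\Gamma\subset G$ is a lattice (discrete cocompact subgroup) acting by left translations. A complex structure operator on a real Lie algebra $\mathfrak{g}$ is an $\mathbb{R}$-linear $I:\mathfrak{g}\to\mathfrak{g}$ with $I^2=-\mathrm{Id}$ such that the $\sqrt{-1}$-eigenspace $\mathfrak{g}^{1,0}\subset\mathfrak{g}\otimes\mathbb{C}$ is a Lie subalgebra. A hypercomplex structure on $\mathfrak{g}$ is a triple $I,J,K$ of complex structure operators satisfying the quaternionic relations $I^2=J^2=K^2=-\mathrm{Id}$, $IJ=K$; this is the same as a left-invariant hypercomplex structure on $G$. A hypercomplex nilmanifold is $(N=\Gamma\backslash G,I,J,K)$ where $N$ is a nilmanifold and $I,J,K$ are induced by a left-invariant hypercomplex structure on $G$. The Obata connection is the unique torsion-free connection $\nabla$ with $\nabla I=\nabla J=\nabla K=0$. It is left-invariant and on left-invariant vector fields, i.e. on $\mathfrak{g}$, it is given by $$\nabla_XY=\tfrac12\big([X,Y]+I[IX,Y]-J[X,JY]+K[IX,JY]\big),\qquad X,Y\in\mathfrak{g}.$$ It is flat if $[\nabla_X,\nabla_Y]-\nabla_{[X,Y]}=0$ for all $X,Y\in\mathfrak{g}$.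 For a subspace $V\subset\mathfrak{g}$ put $\mathbb{H}V:=V+IV+JV+KV$. For a nilpotent hypercomplex Lie algebra $\mathfrak{g}$ define inductively $\mathfrak{g}_0^{\mathbb{H}}:=\mathfrak{g}$ and $\mathfrak{g}_i^{\mathbb{H}}:=\mathbb{H}[\mathfrak{g}_{i-1}^{\mathbb{H}},\mathfrak{g}_{i-1}^{\mathbb{H}}]$ for $i\ge 1$, where $[V,V]$ is the linear span of brackets. The Lie algebra $\mathfrak{g}$ is called $\mathbb{H}$-solvable if $\mathfrak{g}_k^{\mathbb{H}}=0$ for some integer $k>0$. *)

theory Defs
  imports "HOL-Analysis.Analysis" "HOL-Algebra.Coset" "HOL-Algebra.Generated_Groups"
begin

section \<open>Smooth maps and smooth manifolds\<close>

text \<open>Sensible for open sets in finite-dimensional spaces: there, all directional derivatives being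
  of class \<open>C\<^sup>k\<close> is the same as the total derivative being of class \<open>C\<^sup>k\<close>.\<close>

primrec Ck_on :: "nat \<Rightarrow> ('a::real_normed_vector \<Rightarrow> 'b::real_normed_vector) \<Rightarrow> 'a set \<Rightarrow> bool" where
  "Ck_on 0 f S \<longleftrightarrow> continuous_on S f"
| "Ck_on (Suc k) f S \<longleftrightarrow>
     (\<exists>f'. (\<forall>x\<in>S. (f has_derivative f' x) (at x)) \<and> (\<forall>v. Ck_on k (\<lambda>x. f' x v) S))"

definition smooth_on :: "('a::real_normed_vector \<Rightarrow> 'b::real_normed_vector) \<Rightarrow> 'a set \<Rightarrow> bool" where
  "smooth_on f S \<longleftrightarrow> (\<forall>k. Ck_on k f S)"

text \<open>A chart is a pair \<open>(U, \<phi>)\<close>. The underlying set \<open>M\<close> of a manifold is a subset of a Hausdorff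
  space and carries the subspace topology.\<close>

type_synonym ('m, 'a) chart = "'m set \<times> ('m \<Rightarrow> 'a)"

definition chart_on :: "'m::t2_space set \<Rightarrow> ('m, 'a::real_normed_vector) chart \<Rightarrow> bool" where
  "chart_on M c \<longleftrightarrow> (case c of (U, \<phi>) \<Rightarrow>
     openin (top_of_set M) U \<and> open (\<phi> ` U) \<and> (\<exists>\<psi>. homeomorphism U (\<phi> ` U) \<phi> \<psi>))"

definition smooth_atlas :: "'m::t2_space set \<Rightarrow> ('m, 'a::real_normed_vector) chart set \<Rightarrow> bool" where
  "smooth_atlas M A \<longleftrightarrow>
     (\<forall>c\<in>A. chart_on M c) \<and> (\<Union>c\<in>A. fst c) = M \<and>
     (\<forall>(U, \<phi>)\<in>A. \<forall>(V, \<psi>)\<in>A. smooth_on (\<psi> \<circ> inv_into U \<phi>) (\<phi> ` (U \<inter> V)))"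

text \<open>The model space is only required to be a finite-dimensional normed space rather than of class
  \<open>euclidean_space\<close>, because the latter excludes dimension zero.\<close>

definition smooth_manifold :: "'m::t2_space set \<Rightarrow> ('m, 'a::real_normed_vector) chart set \<Rightarrow> bool" where
  "smooth_manifold M A \<longleftrightarrow>
     (\<exists>B::'a set. finite B \<and> span B = UNIV) \<and>
     second_countable (top_of_set M) \<and> smooth_atlas M A"

definition prod_atlas ::
  "('m, 'a) chart set \<Rightarrow> ('n, 'b) chart set \<Rightarrow> ('m \<times> 'n, 'a \<times> 'b) chart set" where
  "prod_atlas A B = {(U \<times> V, map_prod \<phi> \<psi>) | U \<phi> V \<psi>. (U, \<phi>) \<in> A \<and> (V, \<psi>) \<in> B}"

definition smooth_map ::
  "'m::t2_space set \<Rightarrow> ('m, 'a::real_normed_vector) chart set \<Rightarrow>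
   'n::t2_space set \<Rightarrow> ('n, 'b::real_normed_vector) chart set \<Rightarrow> ('m \<Rightarrow> 'n) \<Rightarrow> bool" where
  "smooth_map M A N B f \<longleftrightarrow>
     continuous_on M f \<and> f ` M \<subseteq> N \<and>
     (\<forall>(U, \<phi>)\<in>A. \<forall>(V, \<psi>)\<in>B. smooth_on (\<psi> \<circ> f \<circ> inv_into U \<phi>) (\<phi> ` (U \<inter> f -` V)))"


section \<open>Lie groups and their Lie algebras\<close>

definition lie_group ::
  "('g::t2_space, 'z) monoid_scheme \<Rightarrow> ('g, 'a::real_normed_vector) chart set \<Rightarrow> bool" where
  "lie_group G A \<longleftrightarrow>
     group G \<and> smooth_manifold (carrier G) A \<and>
     smooth_map (carrier G \<times> carrier G) (prod_atlas A A) (carrier G) A (\<lambda>(x, y). x \<otimes>\<^bsub>G\<^esub> y) \<and>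
     smooth_map (carrier G) A (carrier G) A (\<lambda>x. inv\<^bsub>G\<^esub> x)"

text \<open>A chart \<open>c = (U, \<phi>)\<close> around \<open>\<one>\<close> identifies the tangent space of \<open>G\<close> at \<open>\<one>\<close> with the model
  space. In this chart, \<open>left_inv_field G c X\<close> is the left-invariant vector field with value
  \<open>X\<close> at \<open>\<one>\<close>: its value at \<open>g\<close> is the image of \<open>X\<close> under the differential at \<open>\<one>\<close> of left translation
  by \<open>g\<close>. The bracket on \<open>Lie(G)\<close> is the bracket \<open>[V, W] = DW V - DV W\<close> of left-invariant vector
  fields, evaluated at \<open>\<one>\<close>. Another chart around \<open>\<one>\<close> gives an isomorphic Lie algebra.\<close>

definition left_inv_field ::
  "('g, 'z) monoid_scheme \<Rightarrow> ('g, 'a::real_normed_vector) chart \<Rightarrow> 'a \<Rightarrow> 'a \<Rightarrow> 'a" where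
  "left_inv_field G c X p = (case c of (U, \<phi>) \<Rightarrow>
     frechet_derivative (\<lambda>q. \<phi> (inv_into U \<phi> p \<otimes>\<^bsub>G\<^esub> inv_into U \<phi> q)) (at (\<phi> \<one>\<^bsub>G\<^esub>)) X)"

definition lie_bracket ::
  "('g, 'z) monoid_scheme \<Rightarrow> ('g, 'a::real_normed_vector) chart \<Rightarrow> 'a \<Rightarrow> 'a \<Rightarrow> 'a" where
  "lie_bracket G c X Y =
     frechet_derivative (left_inv_field G c Y) (at (snd c \<one>\<^bsub>G\<^esub>)) X
   - frechet_derivative (left_inv_field G c X) (at (snd c \<one>\<^bsub>G\<^esub>)) Y"


section \<open>Nilmanifolds\<close>

primrec lower_central :: "('g, 'z) monoid_scheme \<Rightarrow> nat \<Rightarrow> 'g set" where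
  "lower_central G 0 = carrier G"
| "lower_central G (Suc n) = generate G
     {x \<otimes>\<^bsub>G\<^esub> y \<otimes>\<^bsub>G\<^esub> inv\<^bsub>G\<^esub> x \<otimes>\<^bsub>G\<^esub> inv\<^bsub>G\<^esub> y | x y. x \<in> carrier G \<and> y \<in> lower_central G n}"

definition nilpotent_group :: "('g, 'z) monoid_scheme \<Rightarrow> bool" where
  "nilpotent_group G \<longleftrightarrow> group G \<and> (\<exists>n. lower_central G n = {\<one>\<^bsub>G\<^esub>})"

text \<open>The space of orbits \<open>\<Gamma>g\<close> of \<open>\<Gamma>\<close> acting by left translations, i.e. of right cosets,
  with the quotient topology.\<close>

definition left_quotient :: "'g::topological_space set \<Rightarrow> ('g, 'z) monoid_scheme \<Rightarrow> 'g set topology" where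
  "left_quotient \<Gamma> G =
     topology (\<lambda>\<U>. \<U> \<subseteq> rcosets\<^bsub>G\<^esub> \<Gamma> \<and> openin (top_of_set (carrier G)) (\<Union>\<U>))"

definition lattice_in :: "'g::topological_space set \<Rightarrow> ('g, 'z) monoid_scheme \<Rightarrow> bool" where
  "lattice_in \<Gamma> G \<longleftrightarrow> subgroup \<Gamma> G \<and> discrete \<Gamma> \<and> compact_space (left_quotient \<Gamma> G)"

definition nilmanifold ::
  "'g::t2_space set \<Rightarrow> ('g, 'z) monoid_scheme \<Rightarrow> ('g, 'a::real_normed_vector) chart set \<Rightarrow> bool" where
  "nilmanifold \<Gamma> G A \<longleftrightarrow>
     lie_group G A \<and> connected (carrier G) \<and> simply_connected (carrier G) \<and>
     nilpotent_group G \<and> lattice_in \<Gamma> G"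


section \<open>Hypercomplex structures on a Lie algebra\<close>

text \<open>The pair \<open>(X, Y)\<close> stands for \<open>X + \<i>Y\<close> in the complexification of the Lie algebra.\<close>

definition complexified_bracket ::
  "('a \<Rightarrow> 'a \<Rightarrow> 'a) \<Rightarrow> 'a \<times> 'a \<Rightarrow> 'a \<times> 'a \<Rightarrow> 'a::real_vector \<times> 'a" where
  "complexified_bracket br Z W =
     (br (fst Z) (fst W) - br (snd Z) (snd W), br (fst Z) (snd W) + br (snd Z) (fst W))"

definition imag_mult :: "'a::real_vector \<times> 'a \<Rightarrow> 'a \<times> 'a" where
  "imag_mult Z = (- snd Z, fst Z)"

definition eigenspace_10 :: "('a::real_vector \<Rightarrow> 'a) \<Rightarrow> ('a \<times> 'a) set" where
  "eigenspace_10 I = {Z. map_prod I I Z = imag_mult Z}"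

text \<open>For linear \<open>I\<close>, \<open>eigenspace_10 I\<close> is a complex subspace, so being a Lie subalgebra
  means closure under the bracket.\<close>

definition complex_structure_operator ::
  "('a \<Rightarrow> 'a \<Rightarrow> 'a) \<Rightarrow> ('a::real_vector \<Rightarrow> 'a) \<Rightarrow> bool" where
  "complex_structure_operator br I \<longleftrightarrow>
     linear I \<and> (\<forall>X. I (I X) = - X) \<and>
     (\<forall>Z\<in>eigenspace_10 I. \<forall>W\<in>eigenspace_10 I. complexified_bracket br Z W \<in> eigenspace_10 I)"

definition hypercomplex_structure ::
  "('a \<Rightarrow> 'a \<Rightarrow> 'a) \<Rightarrow> ('a::real_vector \<Rightarrow> 'a) \<Rightarrow> ('a \<Rightarrow> 'a) \<Rightarrow> ('a \<Rightarrow> 'a) \<Rightarrow> bool" where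
  "hypercomplex_structure br I J K \<longleftrightarrow>
     complex_structure_operator br I \<and> complex_structure_operator br J \<and>
     complex_structure_operator br K \<and> (\<forall>X. I (J X) = K X)"

definition obata ::
  "('a \<Rightarrow> 'a \<Rightarrow> 'a) \<Rightarrow> ('a::real_vector \<Rightarrow> 'a) \<Rightarrow> ('a \<Rightarrow> 'a) \<Rightarrow> ('a \<Rightarrow> 'a) \<Rightarrow> 'a \<Rightarrow> 'a \<Rightarrow> 'a" where
  "obata br I J K X Y =
     (1/2) *\<^sub>R (br X Y + I (br (I X) Y) - J (br X (J Y)) + K (br (I X) (J Y)))"

definition obata_flat ::
  "('a \<Rightarrow> 'a \<Rightarrow> 'a) \<Rightarrow> ('a::real_vector \<Rightarrow> 'a) \<Rightarrow> ('a \<Rightarrow> 'a) \<Rightarrow> ('a \<Rightarrow> 'a) \<Rightarrow> bool" where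
  "obata_flat br I J K \<longleftrightarrow> (let D = obata br I J K in
     \<forall>X Y Z. D X (D Y Z) - D Y (D X Z) - D (br X Y) Z = 0)"

definition bracket_span :: "('a \<Rightarrow> 'a \<Rightarrow> 'a::real_vector) \<Rightarrow> 'a set \<Rightarrow> 'a set" where
  "bracket_span br V = span {br X Y | X Y. X \<in> V \<and> Y \<in> V}"

definition quat_sum ::
  "('a::real_vector \<Rightarrow> 'a) \<Rightarrow> ('a \<Rightarrow> 'a) \<Rightarrow> ('a \<Rightarrow> 'a) \<Rightarrow> 'a set \<Rightarrow> 'a set" where
  "quat_sum I J K V = {a + I b + J c + K d | a b c d. a \<in> V \<and> b \<in> V \<and> c \<in> V \<and> d \<in> V}"

primrec H_series ::
  "('a \<Rightarrow> 'a \<Rightarrow> 'a) \<Rightarrow> ('a::real_vector \<Rightarrow> 'a) \<Rightarrow> ('a \<Rightarrow> 'a) \<Rightarrow> ('a \<Rightarrow> 'a) \<Rightarrow> nat \<Rightarrow> 'a set" where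
  "H_series br I J K 0 = UNIV"
| "H_series br I J K (Suc i) = quat_sum I J K (bracket_span br (H_series br I J K i))"

definition H_solvable ::
  "('a \<Rightarrow> 'a \<Rightarrow> 'a) \<Rightarrow> ('a::real_vector \<Rightarrow> 'a) \<Rightarrow> ('a \<Rightarrow> 'a) \<Rightarrow> ('a \<Rightarrow> 'a) \<Rightarrow> bool" where
  "H_solvable br I J K \<longleftrightarrow> (\<exists>k>0. H_series br I J K k = {0})"


section \<open>Consistency checks\<close>

text \<open>\<open>topology\<close> is only meaningful on predicates satisfying \<open>istopology\<close>.\<close>

lemma openin_left_quotient:
  assumes "group G" "subgroup \<Gamma> G"
  shows "openin (left_quotient \<Gamma> G) \<U> \<longleftrightarrow>
    \<U> \<subseteq> rcosets\<^bsub>G\<^esub> \<Gamma> \<and> openin (top_of_set (carrier G)) (\<Union>\<U>)"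
proof -
  have disj: "\<Union>(S \<inter> T) = \<Union>S \<inter> \<Union>T" if "S \<subseteq> rcosets\<^bsub>G\<^esub> \<Gamma>" "T \<subseteq> rcosets\<^bsub>G\<^esub> \<Gamma>" for S T
  proof
    show "\<Union>S \<inter> \<Union>T \<subseteq> \<Union>(S \<inter> T)"
    proof
      fix x assume "x \<in> \<Union>S \<inter> \<Union>T"
      then obtain s t where st: "s \<in> S" "x \<in> s" "t \<in> T" "x \<in> t" by blast
      have "s = t"
        using group.rcos_disjoint[OF assms] st that by (auto simp: pairwise_def disjnt_def)
      with st show "x \<in> \<Union>(S \<inter> T)" by blast
    qed
  qed blast
  have "istopology (\<lambda>\<U>. \<U> \<subseteq> rcosets\<^bsub>G\<^esub> \<Gamma> \<and> openin (top_of_set (carrier G)) (\<Union>\<U>))"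
    unfolding istopology_def
  proof (intro conjI allI impI)
    fix \<K> assume K: "\<forall>k\<in>\<K>. k \<subseteq> rcosets\<^bsub>G\<^esub> \<Gamma> \<and> openin (top_of_set (carrier G)) (\<Union>k)"
    have "\<Union>(\<Union>\<K>) = \<Union>((\<lambda>k. \<Union>k) ` \<K>)" by blast
    then show "openin (top_of_set (carrier G)) (\<Union>(\<Union>\<K>))"
      using K by (metis (no_types, lifting) imageE openin_Union)
  qed (use disj in auto)
  then show ?thesis
    by (simp add: left_quotient_def topology_inverse')
qed

text \<open>\<open>obata\<close> is the unique left-invariant torsion-free connection that preserves
  \<open>I\<close>, \<open>J\<close> and \<open>K\<close>.\<close>

lemma integrable_identity:
  assumes "complex_structure_operator br I" "bilinear br"
  shows "br (I X) (I Y) = br X Y + I (br (I X) Y) + I (br X (I Y))"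
proof -
  have lin: "linear I" and sq: "\<And>X. I (I X) = - X"
    using assms(1) by (auto simp: complex_structure_operator_def)
  have mem: "(Z, - I Z) \<in> eigenspace_10 I" for Z
    by (simp add: eigenspace_10_def imag_mult_def linear_neg[OF lin] sq)
  have "complexified_bracket br (X, - I X) (Y, - I Y) \<in> eigenspace_10 I"
    using assms(1) mem by (auto simp: complex_structure_operator_def)
  then have "I (br X (- I Y) + br (- I X) Y) = br X Y - br (- I X) (- I Y)"
    by (simp add: eigenspace_10_def imag_mult_def complexified_bracket_def)
  then show ?thesis
    by (simp add: bilinear_lneg[OF assms(2)] bilinear_rneg[OF assms(2)]
        linear_add[OF lin] linear_diff[OF lin] linear_neg[OF lin] algebra_simps)
qed

lemma obata_characterization:
  assumes hc: "hypercomplex_structure br I J K"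
    and bil: "bilinear br" and anti: "\<And>X Y. br X Y = - br Y X"
  shows "(\<forall>X Y. D X Y - D Y X = br X Y) \<and>
         (\<forall>X Y. D X (I Y) = I (D X Y) \<and> D X (J Y) = J (D X Y) \<and> D X (K Y) = K (D X Y))
     \<longleftrightarrow> D = obata br I J K"
proof -
  note co = hc[unfolded hypercomplex_structure_def]
  have lin: "linear I" "linear J" "linear K"
    and sq: "I (I X) = - X" "J (J X) = - X" "K (K X) = - X" and IJ: "I (J X) = K X" for X
    using co by (auto simp: complex_structure_operator_def)
  note l = linear_add[OF lin(1)] linear_add[OF lin(2)] linear_add[OF lin(3)]
    linear_diff[OF lin(1)] linear_diff[OF lin(2)] linear_diff[OF lin(3)]
    linear_neg[OF lin(1)] linear_neg[OF lin(2)] linear_neg[OF lin(3)]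
    linear_scale[OF lin(1)] linear_scale[OF lin(2)] linear_scale[OF lin(3)]
  have IK: "I (K X) = - J X" for X using IJ sq by metis
  have KJ: "K (J X) = - I X" for X by (metis IJ sq(2) linear_neg[OF lin(1)])
  have KJ': "J (K X) = I X" for X
  proof -
    have "I (I (J (K X))) = I (- X)" by (simp only: IJ sq)
    then show ?thesis by (simp add: sq linear_neg[OF lin(1)])
  qed
  have JI: "J (I X) = - K X" for X by (metis KJ' sq(2))
  have KI: "K (I X) = J X" for X
  proof -
    have "K (I X) = I (J (I X))" by (simp only: IJ)
    also have "\<dots> = J X" by (simp only: JI linear_neg[OF lin(1)] IK minus_minus)
    finally show ?thesis .
  qed
  note q = sq IJ IK KJ KJ' JI KI
  have nI: "br (I X) (I Y) = br X Y + I (br (I X) Y) + I (br X (I Y))"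
    and nJ: "br (J X) (J Y) = br X Y + J (br (J X) Y) + J (br X (J Y))"
    and nK: "br (K X) (K Y) = br X Y + K (br (K X) Y) + K (br X (K Y))" for X Y
    using co integrable_identity[OF _ bil] by blast+
  have neg: "br (- X) Y = - br X Y" "br X (- Y) = - br X Y" for X Y
    by (simp_all add: bilinear_lneg[OF bil] bilinear_rneg[OF bil])
  let ?D = "obata br I J K"
  have half: "(1/2) *\<^sub>R a = (1/2) *\<^sub>R b" if "a = b" for a b :: 'a using that by simp
  have cI: "?D X (I Y) = I (?D X Y)" for X Y
  proof -
    have 1: "I (br (I X) (I Y)) = I (br X Y) - br (I X) Y - br X (I Y)"
      by (simp add: nI l q)
    have "br (I X) (I (J Y)) = br X (J Y) + I (br (I X) (J Y)) + I (br X (I (J Y)))" by (rule nI)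
    then have 2: "K (br (I X) (K Y)) = K (br X (J Y)) + J (br (I X) (J Y)) + J (br X (K Y))"
      by (simp add: l q)
    show ?thesis
      unfolding obata_def l by (rule half) (simp add: l q neg 1 2)
  qed
  have cJ: "?D X (J Y) = J (?D X Y)" for X Y
    unfolding obata_def l by (rule half) (simp add: l q neg)
  have cK: "?D X (K Y) = K (?D X Y)" for X Y
    using cI[of X "J Y"] cJ[of X Y] by (simp add: IJ)
  have tor: "?D X Y - ?D Y X = br X Y" for X Y
  proof -
    have e1: "I (br (I X) Y) - I (br (I Y) X) = br (I X) (I Y) - br X Y"
      using nI[of X Y] anti[of "I Y" X] by (simp add: l)
    have e2: "J (br X (J Y)) - J (br Y (J X)) = br (J X) (J Y) - br X Y"
      using nJ[of X Y] anti[of Y "J X"] by (simp add: l)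
    have e3: "K (br (I X) (J Y)) - K (br (I Y) (J X)) = br (J X) (J Y) - br (I X) (I Y)"
      using nK[of "I X" "I Y"] anti[of "I Y" "J X"] by (simp add: l q)
    have "?D X Y - ?D Y X = (1/2) *\<^sub>R ((br X Y - br Y X)
        + (I (br (I X) Y) - I (br (I Y) X)) - (J (br X (J Y)) - J (br Y (J X)))
        + (K (br (I X) (J Y)) - K (br (I Y) (J X))))"
      unfolding obata_def by (simp add: algebra_simps)
    also have "\<dots> = (1/2) *\<^sub>R (br X Y + br X Y)"
      unfolding e1 e2 e3 using anti[of Y X] by simp
    finally show ?thesis by (simp add: scaleR_half_double)
  qed
  show ?thesis
  proof
    assume D: "(\<forall>X Y. D X Y - D Y X = br X Y) \<and>
         (\<forall>X Y. D X (I Y) = I (D X Y) \<and> D X (J Y) = J (D X Y) \<and> D X (K Y) = K (D X Y))"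
    then have b: "br X Y = D X Y - D Y X" for X Y by simp
    have c: "D X (I Y) = I (D X Y)" "D X (J Y) = J (D X Y)" for X Y using D by blast+
    have "?D X Y = (1/2) *\<^sub>R (D X Y + D X Y)" for X Y
      unfolding obata_def by (rule half) (simp add: b c l q)
    then show "D = ?D" by (auto simp: fun_eq_iff scaleR_half_double)
  qed (use tor cI cJ cK in auto)
qed

end

theory Submission
  imports Defs
begin

text \<open>
  Flatness makes \<open>D\<^sub>X = \<nabla>\<^sub>X\<close> a representation of the nilpotent Lie algebra by quaternionic-linear maps,
  and torsion-freeness gives \<open>[X, Y] = D\<^sub>X Y - D\<^sub>Y X\<close>. If all \<open>D\<^sub>X\<close> are nilpotent, an Engel-type
  argument yields a flag of quaternionic subspaces \<open>V\<^sub>i\<close> with \<open>D\<^sub>X V\<^sub>i \<subseteq> V\<^sub>i\<^sub>+\<^sub>1\<close>, so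
  \<open>\<H>[V\<^sub>i, V\<^sub>i] \<subseteq> V\<^sub>i\<^sub>+\<^sub>1\<close> and the algebra is \<open>\<H>\<close>-solvable.

  For the nilpotency, a complex structure \<open>I\<close> on a nilpotent Lie algebra satisfies
  \<open>tr (I ad\<^sub>X) = 0\<close>, hence \<open>tr D\<^sub>X = 0\<close> and the right multiplications \<open>Y \<mapsto> D\<^sub>Y a\<close> are trace-free
  as well. For a fixed \<open>X\<close>, the projection onto the image component of the Fitting decomposition
  of \<open>D\<^sub>X\<close> is such a right multiplication; its rank is its trace, so it vanishes.

  The Lie algebra is nilpotent because the velocities at \<open>1\<close> of curves in the \<open>k\<close>-th term of the
  lower central series of the group span a subspace that bracketing with \<open>X\<close> maps into the next
  one: differentiate the commutator of such a curve with \<open>e + s X\<close>, divide by \<open>s\<close>, let \<open>s \<rightarrow> 0\<close>.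
\<close>

section \<open>Traces of endomorphisms\<close>

text \<open>The ambient type is an abstract real vector space, so the trace is read off from
  coordinates in an explicit basis. It is evaluated only at finite bases of the whole space.\<close>

definition trace_on :: "'a::real_vector set \<Rightarrow> ('a \<Rightarrow> 'a) \<Rightarrow> real" where
  "trace_on B f = (\<Sum>b\<in>B. representation B (f b) b)"

lemma representation_linear:
  assumes "finite B" "independent B" "span B = UNIV" and f: "linear f"
  shows "representation B (f x) c = (\<Sum>b\<in>B. representation B x b * representation B (f b) c)"
proof -
  have "f x = f (\<Sum>b\<in>B. representation B x b *\<^sub>R b)"
    using assms by (subst real_vector.sum_representation_eq) auto
  also have "\<dots> = (\<Sum>b\<in>B. representation B x b *\<^sub>R f b)"
    by (simp add: linear_sum[OF f] linear_scale[OF f])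
  finally show ?thesis
    using assms by (simp add: real_vector.representation_sum real_vector.representation_scale)
qed

lemma trace_on_comp_commute:
  assumes "finite B" "independent B" "span B = UNIV" and f: "linear f" and g: "linear g"
  shows "trace_on B (\<lambda>x. f (g x)) = trace_on B (\<lambda>x. g (f x))"
proof -
  let ?r = "representation B"
  have "trace_on B (\<lambda>x. f (g x)) = (\<Sum>b\<in>B. \<Sum>c\<in>B. ?r (g b) c * ?r (f c) b)"
    unfolding trace_on_def by (subst representation_linear[OF assms(1-3) f]) simp
  also have "\<dots> = (\<Sum>c\<in>B. \<Sum>b\<in>B. ?r (f c) b * ?r (g b) c)"
    by (subst sum.swap) (simp add: mult.commute)
  also have "\<dots> = trace_on B (\<lambda>x. g (f x))"
    unfolding trace_on_def by (subst (2) representation_linear[OF assms(1-3) g]) simp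
  finally show ?thesis .
qed

lemma trace_on_linear:
  assumes "independent B" "span B = UNIV"
  shows "trace_on B (\<lambda>x. f x + g x) = trace_on B f + trace_on B g"
    and "trace_on B (\<lambda>x. f x - g x) = trace_on B f - trace_on B g"
    and "trace_on B (\<lambda>x. r *\<^sub>R f x) = r * trace_on B f"
  using assms by (simp_all add: trace_on_def real_vector.representation_add
      real_vector.representation_diff real_vector.representation_scale
      sum.distrib sum_subtractf sum_distrib_left)

text \<open>If \<open>f g f = f\<close>, then \<open>f\<close> and \<open>f\<^sup>2 g\<close> have the same trace, but the nilpotency index of
  \<open>f\<^sup>2 g\<close> is smaller.\<close>

lemma trace_on_nilpotent:
  assumes "finite B" "independent B" "span B = UNIV"
  shows "linear f \<Longrightarrow> (\<And>x. (f ^^ n) x = 0) \<Longrightarrow> trace_on B f = 0"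
proof (induction n arbitrary: f)
  case 0
  then have "f x = 0" for x by simp
  then show ?case by (simp add: trace_on_def real_vector.representation_zero)
next
  case (Suc n)
  show ?case
  proof (cases "n = 0")
    case True
    with Suc.prems have "f x = 0" for x by simp
    then show ?thesis by (simp add: trace_on_def real_vector.representation_zero)
  next
    case False
    obtain g where g: "linear g" "f (g (f x)) = f x" for x
      using linear_exists_right_inverse_on[OF Suc.prems(1) subspace_UNIV] by auto
    have ff: "linear (\<lambda>x. f (f (g x)))"
      using linear_compose[OF linear_compose[OF g(1) Suc.prems(1)] Suc.prems(1)]
      by (simp add: o_def)
    \<comment> \<open>Each inner \<open>f (g (f x))\<close> collapses to \<open>f x\<close>, so only
      the innermost \<open>g\<close> survives. The formula starts at exponent 1, which is why
      \<open>n = 0\<close> is a separate case.\<close>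
    have pow: "((\<lambda>x. f (f (g x))) ^^ Suc k) x = (f ^^ Suc (Suc k)) (g x)" for k x
    proof (induction k)
      case (Suc k)
      have "((\<lambda>x. f (f (g x))) ^^ Suc (Suc k)) x = f (f (g ((f ^^ Suc (Suc k)) (g x))))"
        using Suc by simp
      then show ?case by (simp add: g(2))
    qed simp
    have "((\<lambda>x. f (f (g x))) ^^ n) x = 0" for x
      using pow[of "n - 1" x] False Suc.prems(2)[of "g x"] by simp
    then have "trace_on B (\<lambda>x. f (f (g x))) = 0"
      by (rule Suc.IH[OF ff])
    moreover have "trace_on B (\<lambda>x. f (f (g x))) = trace_on B (\<lambda>x. f (g (f x)))"
      using trace_on_comp_commute[OF assms Suc.prems(1), of "\<lambda>x. f (g x)"]
        linear_compose[OF g(1) Suc.prems(1)] by (simp add: o_def)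
    ultimately show ?thesis by (simp add: g(2))
  qed
qed

lemma finite_independent:
  fixes B F :: "'a::real_vector set"
  assumes "finite F" "span F = UNIV" "independent B"
  shows "finite B"
  using real_vector.independent_span_bound[of F B] assms by auto

text \<open>In a basis extending a basis of the range, the diagonal entries of a projection are 1 on
  the range part and 0 elsewhere, so the trace is the rank. That basis is chosen inside the proof,
  hence the assumption on all bases.\<close>

lemma idempotent_trace_on_zero:
  fixes E :: "'a::real_vector \<Rightarrow> 'a" and F :: "'a set"
  assumes fin: "finite F" "span F = UNIV" and E: "linear E" "\<And>x. E (E x) = E x"
    and tr: "\<And>B. finite B \<Longrightarrow> independent B \<Longrightarrow> span B = UNIV \<Longrightarrow> trace_on B E = 0"
  shows "E x = 0"
proof -
  obtain B1 where B1: "B1 \<subseteq> range E" "independent B1" "range E \<subseteq> span B1"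
    using real_vector.maximal_independent_subset[of "range E"] by blast
  obtain B where B: "B1 \<subseteq> B" "independent B" "span B = UNIV"
    by (rule real_vector.maximal_independent_subset_extend[of B1 UNIV]) (use B1(2) in auto)
  have finB: "finite B" by (rule finite_independent[OF fin B(2)])
  have "representation B (E b) b = (if b \<in> B1 then 1 else 0)" if b: "b \<in> B" for b
  proof (cases "b \<in> B1")
    case True
    then have "E b = b" using B1(1) E(2) by auto
    then show ?thesis using True b by (simp add: real_vector.representation_basis[OF B(2)])
  next
    case False
    have "E b \<in> span B1" using B1 by auto
    then have "representation B (E b) = representation B1 (E b)"
      by (rule real_vector.representation_extend[OF B(2) _ B(1)])
    moreover have "representation B1 (E b) b = 0"
      using real_vector.representation_ne_zero[of B1 "E b" b] False by blast
    ultimately show ?thesis using False by simp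
  qed
  then have "trace_on B E = (\<Sum>b\<in>B. if b \<in> B1 then 1 else 0)"
    by (simp add: trace_on_def)
  also have "\<dots> = real (card B1)"
    using finB B(1) by (simp flip: sum.inter_restrict add: Int_absorb1)
  finally have "card B1 = 0" using tr[OF finB B(2,3)] by simp
  then have "B1 = {}" using finB B(1) finite_subset by fastforce
  then have "range E \<subseteq> {0}" using B1(3) by simp
  then show ?thesis by auto
qed

section \<open>Stabilisation of kernels and images\<close>

lemma linear_funpow: "linear (f :: 'a::real_vector \<Rightarrow> 'a) \<Longrightarrow> linear (f ^^ n)"
proof (induction n)
  case (Suc n)
  then show ?case using linear_compose[of "f ^^ n" f] by (simp add: o_def)
qed (simp add: linear_id)

text \<open>The ranges decrease, so an exponent with range of least dimension works: if a later
  range missed a vector of this one, its dimension would be smaller still.\<close>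

lemma range_funpow_stable:
  fixes f :: "'a::real_vector \<Rightarrow> 'a" and F :: "'a set"
  assumes fin: "finite F" "span F = UNIV" and f: "linear f"
  shows "\<exists>N. \<forall>k. range (f ^^ (N + k)) = range (f ^^ N)"
proof -
  define N where "N = (ARG_MIN (\<lambda>n. dim (range (f ^^ n))) n. True)"
  have N: "dim (range (f ^^ N)) \<le> dim (range (f ^^ n))" for n
    using arg_min_nat_lemma[of "\<lambda>n. True" N "\<lambda>n. dim (range (f ^^ n))"]
    unfolding N_def by (simp add: arg_min_nat_le)
  have sub: "range (f ^^ (N + k)) \<subseteq> range (f ^^ N)" for k
    by (auto simp: funpow_add)
  have "range (f ^^ N) \<subseteq> range (f ^^ (N + k))" for k
  proof (rule ccontr)
    assume "\<not> ?thesis"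
    then obtain x where x: "x \<in> range (f ^^ N)" "x \<notin> range (f ^^ (N + k))" by blast
    have s: "subspace (range (f ^^ n))" for n
      by (rule linear_subspace_image[OF linear_funpow[OF f] subspace_UNIV])
    obtain C where C: "C \<subseteq> range (f ^^ (N + k))" "independent C"
        "range (f ^^ (N + k)) \<subseteq> span C" "card C = dim (range (f ^^ (N + k)))"
      using real_vector.basis_exists by blast
    obtain D where D: "D \<subseteq> range (f ^^ N)" "independent D"
        "range (f ^^ N) \<subseteq> span D" "card D = dim (range (f ^^ N))"
      using real_vector.basis_exists by blast
    have "x \<notin> span C" using x(2) span_minimal[OF C(1) s] by blast
    then have i: "independent (insert x C)" "x \<notin> C"
      using C(2) by (auto simp: real_vector.independent_insert span_base)
    have "insert x C \<subseteq> span D" using x C(1) D(3) sub by blast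
    then have "card (insert x C) \<le> card D"
      using real_vector.independent_span_bound[OF finite_independent[OF fin D(2)] i(1)] by blast
    then show False
      using i(2) finite_independent[OF fin C(2)] N[of "N + k"] C(4) D(4) by simp
  qed
  with sub show ?thesis by blast
qed

text \<open>A maximal independent set of vectors killed by some power is finite. The sum of their
  exponents dominates each of them, so that power kills the whole span.\<close>

lemma ker_funpow_stable:
  fixes f :: "'a::real_vector \<Rightarrow> 'a" and F :: "'a set"
  assumes fin: "finite F" "span F = UNIV" and f: "linear f"
  shows "\<exists>N. \<forall>v n. (f ^^ n) v = 0 \<longrightarrow> (f ^^ N) v = 0"
proof -
  let ?Z = "{v. \<exists>n. (f ^^ n) v = 0}"
  obtain C where C: "C \<subseteq> ?Z" "independent C" "?Z \<subseteq> span C"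
    using real_vector.maximal_independent_subset[of ?Z] by blast
  have finC: "finite C" by (rule finite_independent[OF fin C(2)])
  obtain h where h: "\<And>v. v \<in> C \<Longrightarrow> (f ^^ h v) v = 0" using C(1) by (simp add: subset_iff) metis
  let ?N = "sum h C"
  have "(f ^^ ?N) v = 0" if "v \<in> C" for v
  proof -
    have "h v \<le> ?N" using that finC by (intro member_le_sum) auto
    then have "f ^^ ?N = f ^^ (?N - h v) \<circ> f ^^ h v" by (simp flip: funpow_add)
    then show ?thesis using h[OF that] linear_0[OF linear_funpow[OF f]] by simp
  qed
  then have "C \<subseteq> {v. (f ^^ ?N) v = 0}" by blast
  then have "span C \<subseteq> {v. (f ^^ ?N) v = 0}"
    by (rule span_minimal[OF _ linear_subspace_kernel[OF linear_funpow[OF f]]])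
  then show ?thesis using C(3) by blast
qed

section \<open>Flat hypercomplex structures on nilpotent Lie algebras\<close>

text \<open>Nilpotency enters through a filtration \<open>C\<close> that every \<open>br X\<close>
  shifts by one and that reaches zero at \<open>n\<close>. For a Lie group it is made of spans of
  velocities of curves in the lower central series. \<open>F\<close> witnesses finite
  dimension.\<close>

locale flat_hypercomplex =
  fixes br :: "'a \<Rightarrow> 'a \<Rightarrow> 'a::real_vector" and I J K :: "'a \<Rightarrow> 'a"
    and C :: "nat \<Rightarrow> 'a set" and n :: nat and F :: "'a set"
  assumes fin: "finite F" "span F = UNIV"
    and bil: "bilinear br" and anti: "br X Y = - br Y X"
    and hc: "hypercomplex_structure br I J K" and flat: "obata_flat br I J K"
    and subspace_C: "subspace (C k)" and C_0: "C 0 = UNIV" and C_n: "C n = {0}"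
    and C_Suc: "Y \<in> C k \<Longrightarrow> br X Y \<in> C (Suc k)"
begin

abbreviation D :: "'a \<Rightarrow> 'a \<Rightarrow> 'a" where
  "D \<equiv> obata br I J K"

lemma linear_IJK: "linear I" "linear J" "linear K"
  and squares: "I (I X) = - X" "J (J X) = - X" "K (K X) = - X" and IJ: "I (J X) = K X"
  using hc by (auto simp: hypercomplex_structure_def complex_structure_operator_def)

lemma JK: "J (K X) = I X"
proof -
  have "I (I (J (K X))) = I (- X)" by (simp only: IJ squares)
  then show ?thesis by (simp add: squares linear_neg[OF linear_IJK(1)])
qed

lemma linear_br: "linear (br X)" "linear (\<lambda>X. br X Y)"
  using bil by (auto simp: bilinear_def)

lemma linear_D: "linear (D X)" "linear (\<lambda>X. D X Y)"
proof -
  note l = linear_IJK linear_br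
  note [simp] = l[THEN linear_add] l[THEN linear_scale]
  show "linear (D X)" "linear (\<lambda>X. D X Y)"
    by (rule linearI; simp add: obata_def algebra_simps)+
qed

lemmas D_simps = linear_D(1)[THEN linear_add] linear_D(1)[THEN linear_diff]
  linear_D(1)[THEN linear_0] linear_D(2)[THEN linear_add] linear_D(2)[THEN linear_diff]
  linear_D(2)[THEN linear_0]

lemma torsion_free: "D X Y - D Y X = br X Y"
  and D_commute: "D X (I Y) = I (D X Y)" "D X (J Y) = J (D X Y)" "D X (K Y) = K (D X Y)"
proof -
  note obata_characterization[OF hc bil anti, THEN iffD2, OF refl]
  then show "D X Y - D Y X = br X Y" "D X (I Y) = I (D X Y)" "D X (J Y) = J (D X Y)"
    "D X (K Y) = K (D X Y)" by blast+
qed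

lemma flatness: "D X (D Y Z) = D Y (D X Z) + D (br X Y) Z"
proof -
  have "D X (D Y Z) - D Y (D X Z) - D (br X Y) Z = 0"
    using flat unfolding obata_flat_def Let_def by blast
  then show ?thesis by (simp add: algebra_simps)
qed

section \<open>Vanishing traces of the adjoint and Obata operators\<close>

lemma ad_nilpotent: "(br X ^^ n) Y = 0"
proof -
  have "(br X ^^ k) Y \<in> C k" for k
    by (induction k) (auto simp: C_0 intro: C_Suc)
  then show ?thesis using C_n by auto
qed

lemma trace_ad:
  assumes "finite B" "independent B" "span B = UNIV"
  shows "trace_on B (br X) = 0"
  using trace_on_nilpotent[OF assms linear_br(1) ad_nilpotent] .

text \<open>The operator \<open>W \<mapsto> [Y, W] - [IY, IW]\<close> is the adjoint action of \<open>Y - \<i> I Y\<close> on the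
  nilpotent complex Lie algebra of vectors of type \<open>(1,0)\<close>, identified with the real Lie algebra
  by \<open>W \<mapsto> W - \<i> I W\<close>.\<close>

lemma trace_ad_I:
  assumes B: "finite B" "independent B" "span B = UNIV"
  shows "trace_on B (\<lambda>W. br Y (I W)) = 0" "trace_on B (\<lambda>W. I (br Y W)) = 0"
proof -
  have *: "trace_on B (\<lambda>W. br (I Y) (I W)) = 0" for Y
  proof -
    define S where "S = (\<lambda>W. br Y W - br (I Y) (I W))"
    have S: "S W = br Y W - br (I Y) (I W)" for W by (simp add: S_def)
    have linS: "linear S"
      unfolding S_def using linear_compose_sub[OF linear_br(1)
          linear_compose[OF linear_IJK(1) linear_br(1), unfolded o_def]] .
    have IS: "I (S W) = br Y (I W) + br (I Y) W" for W
    proof -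
      have "br (I Y) (I W) = br Y W + I (br (I Y) W) + I (br Y (I W))"
        using hc integrable_identity[OF _ bil] by (auto simp: hypercomplex_structure_def)
      then have "S W = - I (br Y (I W) + br (I Y) W)"
        by (simp add: S_def linear_add[OF linear_IJK(1)])
      then show ?thesis by (simp add: linear_neg[OF linear_IJK(1)] squares)
    qed
    \<comment> \<open>The subspaces \<open>C k\<close> need not be stable under \<open>I\<close>.
      Since both \<open>S W\<close> and \<open>I (S W)\<close> are combinations of brackets with
      \<open>W\<close> and \<open>I W\<close>, the pair is followed through the filtration
      together.\<close>
    have "(S ^^ k) W \<in> C k \<and> I ((S ^^ k) W) \<in> C k" for k W
    proof (induction k)
      case (Suc k)
      have "S ((S ^^ k) W) \<in> C (Suc k)"
        using Suc by (subst S) (intro subspace_diff subspace_C C_Suc; simp)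
      moreover have "I (S ((S ^^ k) W)) \<in> C (Suc k)"
        using Suc by (subst IS) (intro subspace_add subspace_C C_Suc; simp)
      ultimately show ?case by simp
    qed (simp add: C_0)
    then have "(S ^^ n) W = 0" for W using C_n by blast
    then have "trace_on B S = 0" by (rule trace_on_nilpotent[OF B linS])
    then show ?thesis
      using trace_ad[OF B, of Y] unfolding S_def by (simp add: trace_on_linear[OF B(2,3)])
  qed
  \<comment> \<open>Replacing \<open>Y\<close> by \<open>- I Y\<close> turns \<open>I Y\<close> into
    \<open>Y\<close>.\<close>
  show 1: "trace_on B (\<lambda>W. br Y (I W)) = 0" for Y
    using *[of "- I Y"] by (simp add: squares linear_neg[OF linear_IJK(1)])
  show "trace_on B (\<lambda>W. I (br Y W)) = 0"
    using 1[of Y] trace_on_comp_commute[OF B linear_IJK(1) linear_br(1)] by simp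
qed

text \<open>Cyclicity of the trace reduces the four terms of the Obata formula to traces of
  \<open>br X\<close> and of \<open>br (I X)\<close> composed with \<open>I\<close>: the
  \<open>J\<close> term through \<open>J (J Y) = - Y\<close>, the \<open>K\<close> term through
  \<open>J (K Y) = I Y\<close>.\<close>

lemma trace_D:
  assumes B: "finite B" "independent B" "span B = UNIV"
  shows "trace_on B (D X) = 0"
proof -
  have 1: "trace_on B (\<lambda>Y. J (br X (J Y))) = 0"
  proof -
    have "trace_on B (\<lambda>Y. J (br X (J Y))) = trace_on B (\<lambda>Y. br X (J (J Y)))"
      using trace_on_comp_commute[OF B linear_IJK(2) linear_compose[OF linear_IJK(2) linear_br(1)]]
      by (simp add: o_def)
    also have "\<dots> = trace_on B (\<lambda>Y. (-1) *\<^sub>R br X Y)"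
      by (simp add: squares linear_neg[OF linear_br(1)])
    finally show ?thesis
      by (simp only: trace_on_linear[OF B(2,3)] trace_ad[OF B])
  qed
  have 2: "trace_on B (\<lambda>Y. K (br (I X) (J Y))) = 0"
  proof -
    have "trace_on B (\<lambda>Y. K (br (I X) (J Y))) = trace_on B (\<lambda>Y. br (I X) (J (K Y)))"
      using trace_on_comp_commute[OF B linear_IJK(3) linear_compose[OF linear_IJK(2) linear_br(1)]]
      by (simp add: o_def)
    then show ?thesis by (simp add: JK trace_ad_I[OF B])
  qed
  have "trace_on B (D X) = (1/2) * (trace_on B (br X) + trace_on B (\<lambda>Y. I (br (I X) Y))
      - trace_on B (\<lambda>Y. J (br X (J Y))) + trace_on B (\<lambda>Y. K (br (I X) (J Y))))"
    unfolding obata_def[abs_def] by (simp only: trace_on_linear[OF B(2,3)])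
  then show ?thesis
    by (simp add: 1 2 trace_ad[OF B] trace_ad_I[OF B])
qed

lemma trace_right_mult:
  assumes B: "finite B" "independent B" "span B = UNIV"
  shows "trace_on B (\<lambda>Y. D Y X) = 0"
proof -
  have "(\<lambda>Y. D Y X) = (\<lambda>Y. D X Y - br X Y)"
    by (simp add: torsion_free[symmetric])
  then show ?thesis by (simp add: trace_on_linear[OF B(2,3)] trace_D[OF B] trace_ad[OF B])
qed

section \<open>Fitting components and nilpotency of the operators \<open>D X\<close>\<close>

text \<open>By flatness, moving one \<open>D X\<close> past \<open>D Y\<close> either replaces
  \<open>Y\<close> by \<open>br X Y\<close>, lowering \<open>k\<close>, or lets \<open>D X\<close>
  act on \<open>Z\<close>, lowering \<open>j\<close>; after \<open>k + j\<close> factors one of the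
  two has vanished. As \<open>br X\<close> is nilpotent, the null component of \<open>D X\<close> is
  stable under every \<open>D Y\<close>.\<close>

lemma ker_left_ideal:
  "(br X ^^ k) Y = 0 \<Longrightarrow> (D X ^^ j) Z = 0 \<Longrightarrow> (D X ^^ (k + j)) (D Y Z) = 0"
proof (induction k arbitrary: Y Z j)
  case 0
  then show ?case by (simp add: D_simps linear_0[OF linear_funpow[OF linear_D(1)]])
next
  case (Suc k)
  note IH = Suc.IH
  from Suc.prems(2) show ?case
  proof (induction j arbitrary: Z)
    case 0
    then show ?case by (simp add: D_simps linear_0[OF linear_funpow[OF linear_D(1)]]
          del: funpow.simps)
  next
    case (Suc j)
    have "(D X ^^ (Suc k + Suc j)) (D Y Z) = (D X ^^ (k + Suc j)) (D X (D Y Z))"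
      by (simp only: add_Suc funpow_Suc_right o_apply)
    also have "\<dots> = (D X ^^ (k + Suc j)) (D (br X Y) Z) + (D X ^^ (Suc k + j)) (D Y (D X Z))"
      by (simp only: flatness[of X Y] linear_add[OF linear_funpow[OF linear_D(1)]] add.commute
          add_Suc add_Suc_right)
    also have "\<dots> = 0"
      using IH[of "br X Y" "Suc j" Z] Suc.IH[of "D X Z"] Suc.prems \<open>(br X ^^ Suc k) Y = 0\<close>
      by (simp add: funpow_Suc_right del: funpow.simps)
    finally show ?case .
  qed
qed

text \<open>The dual statement for the image component: commuting \<open>D Y\<close> with a factor
  \<open>D X\<close> of \<open>W\<close> either brings that factor to the front or spends it on
  replacing \<open>Y\<close> by \<open>br X Y\<close>, and the latter can happen fewer than
  \<open>k\<close> times before \<open>Y\<close> becomes zero.\<close>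

lemma range_left_ideal:
  "(br X ^^ k) Y = 0 \<Longrightarrow> W \<in> range (D X ^^ (m + k)) \<Longrightarrow> D Y W \<in> range (D X ^^ m)"
proof (induction k arbitrary: Y W m)
  case 0
  then show ?case by (auto simp: D_simps intro!: image_eqI[of _ _ 0]
        simp: linear_0[OF linear_funpow[OF linear_D(1)]])
next
  case (Suc k)
  note IH = Suc.IH
  have sub: "subspace (range (D X ^^ m))" for m
    by (rule linear_subspace_image[OF linear_funpow[OF linear_D(1)] subspace_UNIV])
  from Suc.prems(2) show ?case
  proof (induction m arbitrary: W)
    case 0
    then show ?case by simp
  next
    case (Suc m)
    then obtain u where W: "W = D X ((D X ^^ (m + Suc k)) u)" by auto
    let ?w = "(D X ^^ (m + Suc k)) u"
    obtain z where "D Y ?w = (D X ^^ m) z" using Suc.IH[of ?w] by blast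
    then have "D X (D Y ?w) \<in> range (D X ^^ Suc m)" by auto
    moreover have "D (br X Y) ?w \<in> range (D X ^^ Suc m)"
      using IH[of "br X Y" ?w "Suc m"] \<open>(br X ^^ Suc k) Y = 0\<close>
      by (simp add: funpow_Suc_right del: funpow.simps)
    moreover have "D Y W = D X (D Y ?w) - D (br X Y) ?w"
      by (simp add: W flatness[of X Y])
    ultimately show ?case by (simp only: subspace_diff[OF sub])
  qed
qed

text \<open>In the Fitting decomposition of the whole space under \<open>D X\<close> into the null component and the
  image component, the component of \<open>X\<close> in the latter is \<open>D X a\<close> for some \<open>a\<close> in the image
  component. Then \<open>Y \<mapsto> D Y a\<close> is the projection onto the image component, whose rank is its trace.\<close>

lemma D_nilpotent: "\<exists>p. \<forall>Y. (D X ^^ p) Y = 0"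
proof -
  obtain P where P: "\<And>v m. (D X ^^ m) v = 0 \<Longrightarrow> (D X ^^ P) v = 0"
    using ker_funpow_stable[OF fin linear_D(1)] by blast
  obtain R where R: "\<And>k. range (D X ^^ (R + k)) = range (D X ^^ R)"
    using range_funpow_stable[OF fin linear_D(1)] by blast
  note pow_linear = linear_funpow[OF linear_D(1)]
  \<comment> \<open>The exponent \<open>R + Suc R\<close> leaves \<open>R\<close> factors to place
    \<open>a\<close> in the image component and one more to form \<open>D X a\<close>; then
    \<open>X - D X a\<close> lies in the null component.\<close>
  have "(D X ^^ R) X \<in> range (D X ^^ (R + Suc R))" unfolding R by blast
  then obtain b where b: "(D X ^^ R) X = (D X ^^ (R + Suc R)) b" by blast
  define a where "a = (D X ^^ R) b"
  have "(D X ^^ R) (X - D X a) = 0"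
    by (simp add: linear_diff[OF pow_linear] b a_def funpow_add funpow_swap1)
  then have X0: "(D X ^^ P) (X - D X a) = 0" by (rule P)
  \<comment> \<open>Flatness and torsion-freeness combine into a recursion that replaces
    \<open>Y\<close> by \<open>br X Y\<close> up to a null term. Induction on the nilpotency of
    \<open>br X\<close> then carries the case \<open>Y = X\<close> to all \<open>Y\<close>.\<close>
  have step: "D X (Y - D Y a) = (br X Y - D (br X Y) a) + D Y (X - D X a)" for Y
    by (simp add: D_simps flatness[of X Y] torsion_free[symmetric])
  have "(br X ^^ k) Y = 0 \<Longrightarrow> (D X ^^ P) (Y - D Y a) = 0" for k Y
  proof (induction k arbitrary: Y)
    case 0
    then show ?case by (simp add: D_simps linear_0[OF pow_linear])
  next
    case (Suc k)
    have "(D X ^^ (n + P)) (D Y (X - D X a)) = 0"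
      by (rule ker_left_ideal[OF ad_nilpotent X0])
    then have "(D X ^^ P) (D Y (X - D X a)) = 0" by (rule P)
    moreover have "(D X ^^ P) (br X Y - D (br X Y) a) = 0"
      using Suc by (simp add: funpow_Suc_right del: funpow.simps)
    ultimately have "(D X ^^ Suc P) (Y - D Y a) = 0"
      by (simp add: funpow_Suc_right step linear_add[OF pow_linear] del: funpow.simps)
    then show ?case by (rule P)
  qed
  then have null: "(D X ^^ P) (Y - D Y a) = 0" for Y
    using ad_nilpotent by blast
  have "a \<in> range (D X ^^ (R + n))" unfolding R a_def by blast
  then have range: "D Y a \<in> range (D X ^^ R)" for Y
    by (rule range_left_ideal[OF ad_nilpotent])
  \<comment> \<open>Here \<open>Y - D Y a\<close> lies in both Fitting components, and these meet
    only in zero: writing it as a power \<open>R + P\<close> applied to \<open>u\<close>, the vector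
    \<open>u\<close> is null and already killed by the power \<open>P\<close>.\<close>
  have id: "D Y a = Y" if Y: "Y \<in> range (D X ^^ R)" for Y
  proof -
    have "Y - D Y a \<in> range (D X ^^ R)"
      by (rule subspace_diff[OF linear_subspace_image[OF pow_linear subspace_UNIV] Y range])
    then have "Y - D Y a \<in> range (D X ^^ (R + P))" by (simp only: R)
    then obtain u where u: "Y - D Y a = (D X ^^ (R + P)) u" by blast
    then have "(D X ^^ (P + (R + P))) u = 0"
      using null[of Y] by (simp only: funpow_add o_apply)
    then have "(D X ^^ P) u = 0" by (rule P)
    then show ?thesis using u by (simp add: funpow_add linear_0[OF pow_linear])
  qed
  \<comment> \<open>The map sending \<open>Y\<close> to \<open>D Y a\<close> takes values in the
    image component and is the identity there, so it is a projection; being trace-free, it is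
    zero.\<close>
  have "D Y a = 0" for Y
    using idempotent_trace_on_zero[OF fin linear_D(2) id[OF range] trace_right_mult] by blast
  then have "(D X ^^ R) Y = 0" for Y
    using id[of "(D X ^^ R) Y"] by simp
  then show ?thesis by blast
qed

section \<open>Engel flags of quaternionic subspaces\<close>

definition invariant_subspace :: "'a set \<Rightarrow> bool" where
  "invariant_subspace V \<longleftrightarrow> subspace V \<and> (\<forall>v\<in>V. I v \<in> V \<and> J v \<in> V \<and> K v \<in> V) \<and>
     (\<forall>X. \<forall>v\<in>V. D X v \<in> V)"

text \<open>A chain of subspaces from \<open>{0}\<close> to the last argument, each moved into its
  predecessor by \<open>D s\<close> for \<open>s\<close> in \<open>S\<close>. Every member is stable
  under all \<open>D X\<close>, which is what allows the chain to be refined when \<open>S\<close>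
  grows.\<close>

inductive unipotent_flag :: "'a set \<Rightarrow> 'a set \<Rightarrow> bool" for S where
  zero: "unipotent_flag S {0}"
| step: "unipotent_flag S W \<Longrightarrow> invariant_subspace V \<Longrightarrow> W \<subseteq> V \<Longrightarrow>
     (\<And>s v. s \<in> S \<Longrightarrow> v \<in> V \<Longrightarrow> D s v \<in> W) \<Longrightarrow> unipotent_flag S V"

lemma invariant_unipotent_flag: "unipotent_flag S V \<Longrightarrow> invariant_subspace V"
proof (induction rule: unipotent_flag.induct)
  case zero
  show ?case
    by (simp add: invariant_subspace_def subspace_single_0 D_simps linear_IJK[THEN linear_0])
qed

lemma unipotent_flag_span:
  assumes "unipotent_flag S V" "T \<subseteq> span S"
  shows "unipotent_flag T V"
  using assms(1)
proof (induction rule: unipotent_flag.induct)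
  case (step W V)
  have "D t v \<in> W" if "t \<in> T" "v \<in> V" for t v
  proof -
    have W: "subspace W"
      using invariant_unipotent_flag[OF step.hyps(1)] by (simp add: invariant_subspace_def)
    have "S \<subseteq> {s. D s v \<in> W}" using step.hyps(4) that(2) by blast
    moreover have "subspace {s. D s v \<in> W}"
      using linear_subspace_vimage[OF linear_D(2) W] by (simp add: vimage_def)
    ultimately show ?thesis
      using span_minimal[of S "{s. D s v \<in> W}"] assms(2) that(1) by blast
  qed
  then show ?case using step by (meson unipotent_flag.step)
qed (rule unipotent_flag.zero)

text \<open>Engel's induction step. Each inclusion of \<open>W\<close> in \<open>V\<close> is
  refined by \<open>U j\<close>, the vectors of \<open>V\<close> sent into \<open>W\<close> by the
  \<open>j\<close>-th power of \<open>D x\<close>. Since \<open>br x Y\<close> lies in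
  \<open>S\<close>, the operators \<open>D x\<close> and \<open>D Y\<close> commute on
  \<open>V\<close> modulo \<open>W\<close>, so \<open>U j\<close> is invariant; nilpotency of
  \<open>D x\<close> makes the refinement reach \<open>V\<close>.\<close>

lemma unipotent_flag_insert:
  assumes "unipotent_flag S V" and x: "\<And>Y. br x Y \<in> S"
  shows "unipotent_flag (insert x S) V"
  using assms(1)
proof (induction rule: unipotent_flag.induct)
  case (step W V)
  have invW: "invariant_subspace W" by (rule invariant_unipotent_flag[OF step.hyps(1)])
  define U where "U j = {v \<in> V. (D x ^^ j) v \<in> W}" for j
  have powW: "(D x ^^ j) w \<in> W" if "w \<in> W" for j w
    using that invW by (induction j) (auto simp: invariant_subspace_def)
  have pow_D: "(D x ^^ j) v \<in> W \<Longrightarrow> v \<in> V \<Longrightarrow> (D x ^^ j) (D Y v) \<in> W" for j v Y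
  proof (induction j arbitrary: v)
    case 0
    then show ?case using invW by (simp add: invariant_subspace_def)
  next
    case (Suc j)
    have "(D x ^^ Suc j) (D Y v) = (D x ^^ j) (D Y (D x v)) + (D x ^^ j) (D (br x Y) v)"
      by (simp add: funpow_Suc_right flatness[of x Y] linear_add[OF linear_funpow[OF linear_D(1)]]
          del: funpow.simps)
    moreover have "(D x ^^ j) (D Y (D x v)) \<in> W"
      using Suc step.hyps(2)
      by (simp add: funpow_Suc_right invariant_subspace_def del: funpow.simps)
    moreover have "(D x ^^ j) (D (br x Y) v) \<in> W"
      using step.hyps(4)[OF x Suc.prems(2)] powW by blast
    ultimately show ?case
      using invW by (simp add: invariant_subspace_def subspace_add del: funpow.simps)
  qed
  have pow_IJK: "(D x ^^ j) (I v) = I ((D x ^^ j) v)" "(D x ^^ j) (J v) = J ((D x ^^ j) v)"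
    "(D x ^^ j) (K v) = K ((D x ^^ j) v)" for j v
    by (induction j) (simp_all add: D_commute)
  have invU: "invariant_subspace (U j)" for j
  proof -
    have "subspace (V \<inter> (D x ^^ j) -` W)"
      using invW step.hyps(2)
      by (intro subspace_inter linear_subspace_vimage linear_funpow linear_D)
        (auto simp: invariant_subspace_def)
    then have "subspace (U j)" by (simp add: U_def Int_def vimage_def)
    then show ?thesis
      using invW step.hyps(2) pow_D by (auto simp: invariant_subspace_def U_def pow_IJK)
  qed
  have WU: "W \<subseteq> U j" for j
    using powW step.hyps(3) by (auto simp: U_def)
  have "unipotent_flag (insert x S) (U j)" for j
  proof (induction j)
    case 0
    have "U 0 = W" using step.hyps(3) by (auto simp: U_def)
    then show ?case using step.IH by simp
  next
    case (Suc j)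
    have inc: "U j \<subseteq> U (Suc j)"
      using invW by (auto simp: U_def invariant_subspace_def)
    have "D s v \<in> U j" if s: "s \<in> insert x S" and v: "v \<in> U (Suc j)" for s v
    proof (cases "s = x")
      case True
      then show ?thesis using v step.hyps(2)
        by (auto simp: U_def invariant_subspace_def funpow_Suc_right simp del: funpow.simps)
    next
      case False
      then show ?thesis using s v step.hyps(4)[of s v] WU by (auto simp: U_def)
    qed
    then show ?case by (rule unipotent_flag.step[OF Suc invU inc])
  qed
  moreover obtain p where "\<And>Y. (D x ^^ p) Y = 0" using D_nilpotent by blast
  then have "U p = V"
    using invW by (auto simp: U_def invariant_subspace_def subspace_0)
  ultimately show ?case by metis
qed (rule unipotent_flag.zero)

text \<open>The acting set is enlarged along the filtration, from \<open>C n = {0}\<close> up to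
  \<open>C 0\<close>. To pass from \<open>C (Suc m)\<close> to \<open>C m\<close>, the members of a
  finite spanning set are inserted one by one; their brackets with anything lie in
  \<open>C (Suc m)\<close> already.\<close>

lemma unipotent_flag_UNIV: "unipotent_flag UNIV UNIV"
proof -
  have "unipotent_flag (C (n - k)) UNIV" if "k \<le> n" for k
    using that
  proof (induction k)
    case 0
    have "unipotent_flag {0} UNIV"
      by (rule unipotent_flag.step[OF unipotent_flag.zero])
        (auto simp: invariant_subspace_def D_simps)
    then show ?case by (simp add: C_n)
  next
    case (Suc k)
    define m where "m = n - Suc k"
    have m: "unipotent_flag (C (Suc m)) UNIV" using Suc by (simp add: m_def Suc_diff_Suc)
    obtain T where T: "T \<subseteq> C m" "independent T" "C m \<subseteq> span T"
      using real_vector.maximal_independent_subset by blast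
    have "finite T" by (rule finite_independent[OF fin T(2)])
    then have "unipotent_flag (T \<union> C (Suc m)) UNIV" using T(1)
    proof (induction T rule: finite_induct)
      case (insert x T)
      have "br x Y \<in> C (Suc m)" for Y
        using C_Suc[of x m Y] anti[of x Y] insert.prems subspace_neg[OF subspace_C] by auto
      then show ?case using unipotent_flag_insert[of "T \<union> C (Suc m)" UNIV x] insert by simp
    qed (use m in simp)
    then show ?case
      using unipotent_flag_span[of "T \<union> C (Suc m)" UNIV "C m"] T(3)
        span_mono[of T "T \<union> C (Suc m)"] by (auto simp: m_def)
  qed
  from this[of n] show ?thesis by (simp add: C_0)
qed

section \<open>From the flag to the quaternionic derived series\<close>

lemma zero_in_H_series: "0 \<in> H_series br I J K k"
proof (cases k)
  case (Suc j)
  have "0 \<in> bracket_span br (H_series br I J K j)"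
    by (simp add: bracket_span_def span_zero)
  then show ?thesis
    unfolding Suc H_series.simps quat_sum_def mem_Collect_eq
    by (intro exI[of _ 0]) (simp add: linear_IJK[THEN linear_0])
qed simp

text \<open>Torsion-freeness writes a bracket as \<open>D X Y - D Y X\<close>, which lies in
  \<open>W\<close>; as \<open>W\<close> is quaternionic, it also contains the quaternionic
  hull.\<close>

lemma H_series_step:
  assumes W: "invariant_subspace W" and V: "\<And>X Y. X \<in> V \<Longrightarrow> Y \<in> V \<Longrightarrow> D X Y \<in> W"
    and k: "H_series br I J K k \<subseteq> V"
  shows "H_series br I J K (Suc k) \<subseteq> W"
proof -
  have sub: "subspace W" using W by (simp add: invariant_subspace_def)
  have "br X Y \<in> W" if "X \<in> V" "Y \<in> V" for X Y
    using V[OF that] V[OF that(2,1)] subspace_diff[OF sub] by (simp add: torsion_free[symmetric])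
  then have "bracket_span br (H_series br I J K k) \<subseteq> W"
    unfolding bracket_span_def using k by (intro span_minimal sub) auto
  then show ?thesis
    using W by (auto simp: quat_sum_def invariant_subspace_def subset_iff intro!: subspace_add)
qed

lemma H_solvable: "H_solvable br I J K"
proof -
  have "unipotent_flag UNIV V \<Longrightarrow> H_series br I J K k \<subseteq> V \<Longrightarrow>
      \<exists>m. H_series br I J K m \<subseteq> {0}" for V k
  proof (induction arbitrary: k rule: unipotent_flag.induct)
    case (step W V)
    then show ?case
      using H_series_step[OF invariant_unipotent_flag[OF step.hyps(1)], of V k] by blast
  qed blast
  from this[OF unipotent_flag_UNIV] obtain m where "H_series br I J K m \<subseteq> {0}" by blast
  \<comment> \<open>The index has to be positive, while \<open>m\<close> may be zero, so one further
    step is taken.\<close>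
  then have "H_series br I J K (Suc m) \<subseteq> {0}"
    using H_series_step[OF invariant_unipotent_flag[OF unipotent_flag.zero], of "{0}" m]
    by (simp add: D_simps)
  then have "H_series br I J K (Suc m) = {0}" using zero_in_H_series by blast
  then show ?thesis unfolding H_solvable_def by blast
qed

end

section \<open>Finite-dimensional normed spaces and symmetry of second derivatives\<close>

text \<open>The bound makes the coordinates of a convergent sequence Cauchy, hence convergent. The
  bound is a hypothesis so that the lemma can serve inside the induction that establishes
  it.\<close>

lemma limit_in_span:
  fixes S :: "'a::real_normed_vector set"
  assumes S: "finite S" and bound: "\<And>f. (\<Sum>b\<in>S. \<bar>f b\<bar>) \<le> c * norm (\<Sum>b\<in>S. f b *\<^sub>R b)"
    and x: "\<And>k::nat. x k \<in> span S" and lim: "x \<longlonglongrightarrow> l"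
  shows "l \<in> span S"
proof -
  have "\<exists>f. x k = (\<Sum>b\<in>S. f b *\<^sub>R b)" for k
    using x[of k] span_finite[OF S] by auto
  then obtain f where f: "\<And>k. x k = (\<Sum>b\<in>S. f k b *\<^sub>R b)" by metis
  have "convergent (\<lambda>k. f k b)" if b: "b \<in> S" for b
  proof -
    have le: "dist (f k b) (f j b) \<le> \<bar>c\<bar> * dist (x k) (x j)" for k j
    proof -
      have "\<bar>f k b - f j b\<bar> \<le> (\<Sum>b\<in>S. \<bar>f k b - f j b\<bar>)"
        using member_le_sum[OF b, of "\<lambda>b. \<bar>f k b - f j b\<bar>"] S by simp
      also have "\<dots> \<le> c * norm (x k - x j)"
        using bound[of "\<lambda>b. f k b - f j b"] by (simp add: f scaleR_diff_left sum_subtractf)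
      also have "\<dots> \<le> \<bar>c\<bar> * norm (x k - x j)" by (simp add: mult_right_mono)
      finally show ?thesis by (simp add: dist_norm)
    qed
    have "Cauchy (\<lambda>k. f k b)"
    proof (rule metric_CauchyI)
      fix r :: real assume "0 < r"
      then have "0 < r / (\<bar>c\<bar> + 1)" by simp
      then obtain M where M: "\<And>k j. k \<ge> M \<Longrightarrow> j \<ge> M \<Longrightarrow> dist (x k) (x j) < r / (\<bar>c\<bar> + 1)"
        using metric_CauchyD[OF LIMSEQ_imp_Cauchy[OF lim]] by blast
      have "dist (f k b) (f j b) < r" if "k \<ge> M" "j \<ge> M" for k j
      proof -
        have "dist (f k b) (f j b) \<le> (\<bar>c\<bar> + 1) * dist (x k) (x j)"
          using le[of k j] by (simp add: distrib_right add_increasing2)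
        also have "\<dots> < (\<bar>c\<bar> + 1) * (r / (\<bar>c\<bar> + 1))"
          using M[OF that] by (intro mult_strict_left_mono) auto
        finally show ?thesis by simp
      qed
      then show "\<exists>M. \<forall>k\<ge>M. \<forall>j\<ge>M. dist (f k b) (f j b) < r" by blast
    qed
    then show ?thesis by (simp add: Cauchy_convergent_iff)
  qed
  then obtain g where g: "\<And>b. b \<in> S \<Longrightarrow> (\<lambda>k. f k b) \<longlonglongrightarrow> g b"
    unfolding convergent_def by metis
  then have "x \<longlonglongrightarrow> (\<Sum>b\<in>S. g b *\<^sub>R b)"
    unfolding f by (intro tendsto_intros) auto
  then have "l = (\<Sum>b\<in>S. g b *\<^sub>R b)" using lim LIMSEQ_unique by blast
  then show ?thesis by (simp add: span_sum span_scale span_base)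
qed

text \<open>By induction on the basis: the span of \<open>S\<close> is sequentially closed, so the
  new vector \<open>b\<close> has positive distance \<open>d\<close> from it. This distance bounds
  the coordinate of \<open>b\<close>, and the induction hypothesis bounds the others.\<close>

lemma coordinates_bounded:
  fixes B :: "'a::real_normed_vector set"
  shows "finite B \<Longrightarrow> independent B \<Longrightarrow>
    \<exists>c\<ge>0. \<forall>f. (\<Sum>b\<in>B. \<bar>f b\<bar>) \<le> c * norm (\<Sum>b\<in>B. f b *\<^sub>R b)"
proof (induction B rule: finite_induct)
  case empty
  show ?case by (intro exI[of _ 0]) simp
next
  case (insert b S)
  have ind: "independent S" "b \<notin> span S"
    using insert.prems insert.hyps by (simp_all add: real_vector.independent_insert)
  obtain c where c: "c \<ge> 0" "\<And>f. (\<Sum>b\<in>S. \<bar>f b\<bar>) \<le> c * norm (\<Sum>b\<in>S. f b *\<^sub>R b)"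
    using insert.IH[OF ind(1)] by blast
  have "\<exists>d>0. \<forall>s\<in>span S. d \<le> norm (b + s)"
  proof (rule ccontr)
    assume "\<not> ?thesis"
    then have "\<exists>s\<in>span S. norm (b + s) < inverse (real (Suc k))" for k
      by (metis inverse_positive_iff_positive not_le of_nat_0_less_iff zero_less_Suc)
    then obtain x where x: "\<And>k. x k \<in> span S" "\<And>k. norm (b + x k) < inverse (real (Suc k))"
      by metis
    have "(\<lambda>k. b + x k) \<longlonglongrightarrow> 0"
      by (rule Lim_null_comparison[OF _ LIMSEQ_inverse_real_of_nat])
        (use x(2) in \<open>auto intro: always_eventually less_imp_le\<close>)
    then have "(\<lambda>k. (b + x k) - b) \<longlonglongrightarrow> 0 - b" by (intro tendsto_intros)
    then have "- b \<in> span S" by (intro limit_in_span[OF insert.hyps(1) c(2) x(1)]) simp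
    then show False using ind(2) span_neg[of "- b" S] by simp
  qed
  then obtain d where d: "d > 0" "\<And>s. s \<in> span S \<Longrightarrow> d \<le> norm (b + s)" by blast
  \<comment> \<open>The term \<open>1 / d\<close> accounts for the coordinate of \<open>b\<close>;
    the factor \<open>c * (1 + norm b / d)\<close> for the rest, after removing
    \<open>f b *\<^sub>R b\<close> from the vector.\<close>
  have "(\<Sum>a\<in>insert b S. \<bar>f a\<bar>) \<le> (1 / d + c + c * norm b / d) * norm (\<Sum>a\<in>insert b S. f a *\<^sub>R a)"
    for f
  proof -
    define s where "s = (\<Sum>a\<in>S. f a *\<^sub>R a)"
    have sum: "(\<Sum>a\<in>insert b S. f a *\<^sub>R a) = f b *\<^sub>R b + s"
      using insert.hyps by (simp add: s_def)
    have s: "s \<in> span S" by (auto simp: s_def intro: span_sum span_scale span_base)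
    have "\<bar>f b\<bar> * d \<le> norm (f b *\<^sub>R b + s)"
    proof (cases "f b = 0")
      case False
      have "f b *\<^sub>R (b + s /\<^sub>R f b) = f b *\<^sub>R b + s" using False by (simp add: scaleR_add_right)
      then have "norm (f b *\<^sub>R b + s) = \<bar>f b\<bar> * norm (b + s /\<^sub>R f b)"
        by (metis norm_scaleR)
      then show ?thesis using d(2)[OF span_scale[OF s]] by (simp add: mult_left_mono)
    qed simp
    then have 1: "\<bar>f b\<bar> \<le> norm (f b *\<^sub>R b + s) / d" using d(1) by (simp add: field_simps)
    have "norm s \<le> norm (f b *\<^sub>R b + s) + \<bar>f b\<bar> * norm b"
      using norm_triangle_ineq4[of "f b *\<^sub>R b + s" "f b *\<^sub>R b"] by simp
    also have "\<dots> \<le> norm (f b *\<^sub>R b + s) + norm (f b *\<^sub>R b + s) / d * norm b"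
      using mult_right_mono[OF 1 norm_ge_zero[of b]] by simp
    finally have "c * norm s \<le> c * (norm (f b *\<^sub>R b + s) + norm (f b *\<^sub>R b + s) / d * norm b)"
      using c(1) by (rule mult_left_mono)
    moreover have "(\<Sum>a\<in>insert b S. \<bar>f a\<bar>) \<le> \<bar>f b\<bar> + c * norm s"
      using insert.hyps c(2)[of f] by (simp add: s_def)
    ultimately have "(\<Sum>a\<in>insert b S. \<bar>f a\<bar>) \<le> norm (f b *\<^sub>R b + s) / d
        + c * (norm (f b *\<^sub>R b + s) + norm (f b *\<^sub>R b + s) / d * norm b)"
      using 1 by linarith
    also have "\<dots> = (1 / d + c + c * norm b / d) * norm (f b *\<^sub>R b + s)"
      by (simp add: algebra_simps)
    finally show ?thesis by (simp add: sum)
  qed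
  moreover have "0 \<le> 1 / d + c + c * norm b / d" using c(1) d(1) by simp
  ultimately show ?case by blast
qed

lemma closed_subspace_finite_dim:
  fixes W :: "'a::real_normed_vector set"
  assumes fin: "finite F" "W \<subseteq> span F" and W: "subspace W"
  shows "closed W"
proof -
  obtain B where B: "B \<subseteq> W" "independent B" "W \<subseteq> span B"
    using real_vector.maximal_independent_subset by blast
  have finB: "finite B"
    using real_vector.independent_span_bound[OF fin(1) B(2)] B(1) fin(2) by blast
  have span: "span B = W" using B W span_minimal by blast
  obtain c where c: "\<And>f. (\<Sum>b\<in>B. \<bar>f b\<bar>) \<le> c * norm (\<Sum>b\<in>B. f b *\<^sub>R b)"
    using coordinates_bounded[OF finB B(2)] by blast
  show ?thesis
    unfolding closed_sequential_limits
    using limit_in_span[OF finB c] span by blast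
qed

section \<open>Mean value estimates and symmetry of second derivatives\<close>

lemma vector_derivative_approx:
  fixes g :: "real \<Rightarrow> 'a::real_normed_vector"
  assumes h: "0 \<le> h" and g: "\<And>t. t \<in> {0..h} \<Longrightarrow> (g has_vector_derivative g' t) (at t)"
    and bound: "\<And>t. t \<in> {0..h} \<Longrightarrow> norm (g' t - c) \<le> e"
  shows "norm (g h - g 0 - h *\<^sub>R c) \<le> e * h"
proof -
  have "norm ((g h - h *\<^sub>R c) - (g 0 - 0 *\<^sub>R c)) \<le> e * norm (h - 0)"
  proof (rule differentiable_bound[of "{0..h}"])
    fix t assume t: "t \<in> {0..h}"
    show "((\<lambda>t. g t - t *\<^sub>R c) has_derivative (\<lambda>s. s *\<^sub>R (g' t - c))) (at t within {0..h})"
      using has_derivative_at_withinI[OF g[OF t, unfolded has_vector_derivative_def]]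
      by (auto intro!: derivative_eq_intros simp: scaleR_diff_right)
    have "norm (s *\<^sub>R (g' t - c)) \<le> e * norm s" for s :: real
      using mult_right_mono[OF bound[OF t], of "\<bar>s\<bar>"] by (simp add: mult.commute)
    then show "onorm (\<lambda>s. s *\<^sub>R (g' t - c)) \<le> e"
      by (rule onorm_le)
  qed (use h in auto)
  moreover have "g h - g 0 - h *\<^sub>R c = (g h - h *\<^sub>R c) - (g 0 - 0 *\<^sub>R c)"
    by (simp add: algebra_simps)
  ultimately show ?thesis using h by (simp only: diff_zero real_norm_def abs_of_nonneg)
qed

text \<open>The mean value estimate is applied twice: to \<open>f' x u\<close> along
  \<open>v\<close>, where continuity of \<open>f''\<close> makes the error small, and then along
  \<open>u\<close> to the difference of \<open>f\<close> at points shifted by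
  \<open>h *\<^sub>R v\<close>.\<close>

lemma second_difference_quotient:
  fixes f :: "'a::real_normed_vector \<Rightarrow> 'b::real_normed_vector"
  assumes S: "open S" "z \<in> S"
    and f': "\<And>x. x \<in> S \<Longrightarrow> (f has_derivative f' x) (at x)"
    and f'': "\<And>x. x \<in> S \<Longrightarrow> ((\<lambda>x. f' x u) has_derivative f'' x) (at x)"
    and cont: "continuous_on S (\<lambda>x. f'' x v)" and e: "e > 0"
  shows "\<exists>d>0. \<forall>h. 0 < h \<longrightarrow> h < d \<longrightarrow>
    norm (f (z + h *\<^sub>R u + h *\<^sub>R v) - f (z + h *\<^sub>R u) - f (z + h *\<^sub>R v) + f z - (h * h) *\<^sub>R f'' z v)
      \<le> e * (h * h)"
proof -
  have "isCont (\<lambda>x. f'' x v) z"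
    using cont S continuous_on_eq_continuous_at by blast
  then obtain d1 where d1: "d1 > 0"
      "\<And>x. dist x z < d1 \<Longrightarrow> dist (f'' x v) (f'' z v) < e"
    using e unfolding continuous_at_eps_delta by blast
  obtain d2 where d2: "d2 > 0" "ball z d2 \<subseteq> S" using S open_contains_ball by blast
  \<comment> \<open>For \<open>h < d\<close> the whole parallelogram with sides
    \<open>h *\<^sub>R u\<close> and \<open>h *\<^sub>R v\<close> stays within
    \<open>min d1 d2\<close> of \<open>z\<close>.\<close>
  define d where "d = min d1 d2 / (norm u + norm v + 1)"
  have pos: "0 < norm u + norm v + 1" using norm_ge_zero[of u] norm_ge_zero[of v] by linarith
  have "d > 0" using d1 d2 pos by (simp add: d_def)
  moreover have "norm (f (z + h *\<^sub>R u + h *\<^sub>R v) - f (z + h *\<^sub>R u) - f (z + h *\<^sub>R v) + f z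
      - (h * h) *\<^sub>R f'' z v) \<le> e * (h * h)" if h: "0 < h" "h < d" for h
  proof -
    have near: "dist (z + s *\<^sub>R u + t *\<^sub>R v) z < min d1 d2" if "s \<in> {0..h}" "t \<in> {0..h}" for s t
    proof -
      have "norm (s *\<^sub>R u + t *\<^sub>R v) \<le> s * norm u + t * norm v"
        using norm_triangle_ineq[of "s *\<^sub>R u" "t *\<^sub>R v"] that by simp
      also have "\<dots> \<le> h * norm u + h * norm v"
        using that by (intro add_mono mult_right_mono) auto
      also have "\<dots> \<le> h * (norm u + norm v + 1)" using h by (simp add: algebra_simps)
      also have "\<dots> < d * (norm u + norm v + 1)" using h(2) pos by (rule mult_strict_right_mono)
      also have "\<dots> = min d1 d2" using pos by (simp add: d_def)
      finally show ?thesis by (simp add: dist_norm add.assoc)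
    qed
    have inS: "z + s *\<^sub>R u + t *\<^sub>R v \<in> S" if "s \<in> {0..h}" "t \<in> {0..h}" for s t
      using near[OF that] d2(2) by (auto simp: dist_commute)
    have inner: "norm (f' (z + s *\<^sub>R u + h *\<^sub>R v) u - f' (z + s *\<^sub>R u) u - h *\<^sub>R f'' z v) \<le> e * h"
      if s: "s \<in> {0..h}" for s
    proof -
      have "norm (f' (z + s *\<^sub>R u + h *\<^sub>R v) u - f' (z + s *\<^sub>R u + 0 *\<^sub>R v) u - h *\<^sub>R f'' z v) \<le> e * h"
      proof (rule vector_derivative_approx[where g' = "\<lambda>t. f'' (z + s *\<^sub>R u + t *\<^sub>R v) v"])
        fix t assume t: "t \<in> {0..h}"
        have lin: "linear (f'' (z + s *\<^sub>R u + t *\<^sub>R v))"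
          using f''[OF inS[OF s t]] has_derivative_linear by blast
        have "((\<lambda>t. z + s *\<^sub>R u + t *\<^sub>R v) has_derivative (\<lambda>r. r *\<^sub>R v)) (at t)"
          by (auto intro!: derivative_eq_intros)
        from has_derivative_compose[OF this f''[OF inS[OF s t]]]
        show "((\<lambda>t. f' (z + s *\<^sub>R u + t *\<^sub>R v) u) has_vector_derivative
            f'' (z + s *\<^sub>R u + t *\<^sub>R v) v) (at t)"
          by (simp add: has_vector_derivative_def linear_scale[OF lin])
        show "norm (f'' (z + s *\<^sub>R u + t *\<^sub>R v) v - f'' z v) \<le> e"
          using d1(2)[of "z + s *\<^sub>R u + t *\<^sub>R v"] near[OF s t] by (simp add: dist_norm)
      qed (use h in simp)
      then show ?thesis by simp
    qed
    have "norm ((f (z + h *\<^sub>R u + h *\<^sub>R v) - f (z + h *\<^sub>R u))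
        - (f (z + 0 *\<^sub>R u + h *\<^sub>R v) - f (z + 0 *\<^sub>R u)) - h *\<^sub>R (h *\<^sub>R f'' z v)) \<le> (e * h) * h"
    proof (rule vector_derivative_approx[where
          g' = "\<lambda>s. f' (z + s *\<^sub>R u + h *\<^sub>R v) u - f' (z + s *\<^sub>R u) u"])
      fix s assume s: "s \<in> {0..h}"
      have d: "((\<lambda>s. f (z + s *\<^sub>R u + t *\<^sub>R v)) has_vector_derivative
          f' (z + s *\<^sub>R u + t *\<^sub>R v) u) (at s)" if t: "t \<in> {0..h}" for t
      proof -
        have lin: "linear (f' (z + s *\<^sub>R u + t *\<^sub>R v))"
          using f'[OF inS[OF s t]] has_derivative_linear by blast
        have "((\<lambda>s. z + s *\<^sub>R u + t *\<^sub>R v) has_derivative (\<lambda>r. r *\<^sub>R u)) (at s)"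
          by (auto intro!: derivative_eq_intros)
        from has_derivative_compose[OF this f'[OF inS[OF s t]]] show ?thesis
          by (simp add: has_vector_derivative_def linear_scale[OF lin])
      qed
      show "((\<lambda>s. f (z + s *\<^sub>R u + h *\<^sub>R v) - f (z + s *\<^sub>R u)) has_vector_derivative
          f' (z + s *\<^sub>R u + h *\<^sub>R v) u - f' (z + s *\<^sub>R u) u) (at s)"
        using has_vector_derivative_diff[OF d[of h] d[of 0]] h by simp
    qed (use h inner in auto)
    then show ?thesis by (simp add: algebra_simps)
  qed
  ultimately show ?thesis by blast
qed

text \<open>The second difference is symmetric in \<open>u\<close> and \<open>v\<close>, and divided
  by \<open>h * h\<close> it approximates both mixed derivatives. With a third of their distance as
  tolerance, the two errors cannot add up to that distance.\<close>

lemma second_derivative_symmetric: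
  fixes f :: "'a::real_normed_vector \<Rightarrow> 'b::real_normed_vector"
  assumes S: "open S" "z \<in> S"
    and f': "\<And>x. x \<in> S \<Longrightarrow> (f has_derivative f' x) (at x)"
    and f'': "\<And>u x. x \<in> S \<Longrightarrow> ((\<lambda>x. f' x u) has_derivative f'' u x) (at x)"
    and cont: "\<And>u v. continuous_on S (\<lambda>x. f'' u x v)"
  shows "f'' u z v = f'' v z u"
proof (rule ccontr)
  assume "\<not> ?thesis"
  then have e: "norm (f'' u z v - f'' v z u) / 3 > 0" (is "?e > 0") by simp
  obtain d1 where d1: "d1 > 0" "\<And>h. 0 < h \<Longrightarrow> h < d1 \<Longrightarrow>
    norm (f (z + h *\<^sub>R u + h *\<^sub>R v) - f (z + h *\<^sub>R u) - f (z + h *\<^sub>R v) + f z - (h * h) *\<^sub>R f'' u z v)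
      \<le> ?e * (h * h)"
    using second_difference_quotient[OF S f' f'' cont e] by blast
  obtain d2 where d2: "d2 > 0" "\<And>h. 0 < h \<Longrightarrow> h < d2 \<Longrightarrow>
    norm (f (z + h *\<^sub>R v + h *\<^sub>R u) - f (z + h *\<^sub>R v) - f (z + h *\<^sub>R u) + f z - (h * h) *\<^sub>R f'' v z u)
      \<le> ?e * (h * h)"
    using second_difference_quotient[OF S f' f'' cont e] by blast
  define h where "h = min d1 d2 / 2"
  have h: "0 < h" "h < d1" "h < d2" using d1(1) d2(1) by (auto simp: h_def)
  define \<Delta> where "\<Delta> = f (z + h *\<^sub>R u + h *\<^sub>R v) - f (z + h *\<^sub>R u) - f (z + h *\<^sub>R v) + f z"
  have \<Delta>': "\<Delta> = f (z + h *\<^sub>R v + h *\<^sub>R u) - f (z + h *\<^sub>R v) - f (z + h *\<^sub>R u) + f z"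
    by (simp add: \<Delta>_def add_ac)
  have b: "norm (\<Delta> - (h * h) *\<^sub>R f'' u z v) \<le> ?e * (h * h)"
      "norm (\<Delta> - (h * h) *\<^sub>R f'' v z u) \<le> ?e * (h * h)"
    using d1(2)[OF h(1,2)] d2(2)[OF h(1,3)] unfolding \<Delta>_def[symmetric] \<Delta>'[symmetric] .
  have "(h * h) * norm (f'' u z v - f'' v z u) = norm ((h * h) *\<^sub>R (f'' u z v - f'' v z u))"
    by simp
  also have "\<dots> = norm ((\<Delta> - (h * h) *\<^sub>R f'' v z u) - (\<Delta> - (h * h) *\<^sub>R f'' u z v))"
    by (simp only: scaleR_diff_right) (simp add: algebra_simps)
  also have "\<dots> \<le> ?e * (h * h) + ?e * (h * h)"
    using norm_triangle_ineq4 b add_mono order_trans by meson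
  finally have "(h * h) * norm (f'' u z v - f'' v z u) \<le> (h * h) * (2 * ?e)"
    by (simp add: algebra_simps)
  moreover have "0 < h * h" using h(1) by simp
  ultimately have "norm (f'' u z v - f'' v z u) \<le> 2 * ?e"
    by (rule mult_left_le_imp_le)
  then show False using e by linarith
qed

lemma smooth_on_second_derivatives:
  assumes "smooth_on f S"
  obtains f' f'' where "\<And>x. x \<in> S \<Longrightarrow> (f has_derivative f' x) (at x)"
    and "\<And>u x. x \<in> S \<Longrightarrow> ((\<lambda>x. f' x u) has_derivative f'' u x) (at x)"
    and "\<And>u v. continuous_on S (\<lambda>x. f'' u x v)"
proof -
  have "Ck_on (Suc (Suc 0)) f S" using assms unfolding smooth_on_def by blast
  then obtain f' where f': "\<forall>x\<in>S. (f has_derivative f' x) (at x)"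
      "\<forall>u. \<exists>f''. (\<forall>x\<in>S. ((\<lambda>x. f' x u) has_derivative f'' x) (at x)) \<and>
        (\<forall>v. continuous_on S (\<lambda>x. f'' x v))"
    by auto
  from f'(2) obtain f'' where "\<forall>u. (\<forall>x\<in>S. ((\<lambda>x. f' x u) has_derivative f'' u x) (at x)) \<and>
        (\<forall>v. continuous_on S (\<lambda>x. f'' u x v))"
    by metis
  with f'(1) show ?thesis using that by blast
qed

section \<open>Linear equations near the identity and limits along curves\<close>

text \<open>Convergence to the identity on a finite basis gives convergence in operator norm, with
  error \<eta>. Once \<eta> is below 1/2, the solution satisfies
  \<open>norm (u s) \<le> 2 * norm (v s)\<close>, so \<open>u s - v s\<close> tends to zero. No
  inverse operators have to be formed.\<close>

lemma tendsto_almost_identity: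
  fixes G :: "'s \<Rightarrow> 'a::real_normed_vector \<Rightarrow> 'a"
  assumes B: "finite B" "independent B" "span B = UNIV"
    and G: "\<And>b. b \<in> B \<Longrightarrow> ((\<lambda>s. G s b) \<longlongrightarrow> b) \<F>" "\<forall>\<^sub>F s in \<F>. linear (G s)"
    and u: "\<forall>\<^sub>F s in \<F>. G s (u s) = v s" and v: "(v \<longlongrightarrow> l) \<F>"
  shows "(u \<longlongrightarrow> l) \<F>"
proof -
  obtain c where c: "\<And>f. (\<Sum>b\<in>B. \<bar>f b\<bar>) \<le> c * norm (\<Sum>b\<in>B. f b *\<^sub>R b)" "c \<ge> 0"
    using coordinates_bounded[OF B(1,2)] by blast
  define \<eta> where "\<eta> s = c * (\<Sum>b\<in>B. norm (G s b - b))" for s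
  have "(\<eta> \<longlongrightarrow> c * (\<Sum>b\<in>B. norm (b - b))) \<F>"
    unfolding \<eta>_def by (intro tendsto_intros G)
  then have \<eta>: "(\<eta> \<longlongrightarrow> 0) \<F>" by simp
  have close: "norm (G s x - x) \<le> \<eta> s * norm x" if lin: "linear (G s)" for s x
  proof -
    let ?r = "representation B x"
    have x: "(\<Sum>b\<in>B. ?r b *\<^sub>R b) = x"
      using B by (intro real_vector.sum_representation_eq) auto
    have "G s x - x = (\<Sum>b\<in>B. ?r b *\<^sub>R (G s b - b))"
      by (subst (1 2) x[symmetric])
        (simp add: linear_sum[OF lin] linear_scale[OF lin] scaleR_diff_right sum_subtractf)
    then have "norm (G s x - x) \<le> (\<Sum>b\<in>B. \<bar>?r b\<bar> * norm (G s b - b))"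
      by (metis (no_types, lifting) norm_scaleR norm_sum sum.cong)
    also have "\<dots> \<le> (\<Sum>b\<in>B. \<bar>?r b\<bar> * (\<Sum>b\<in>B. norm (G s b - b)))"
      using B(1) by (intro sum_mono mult_left_mono member_le_sum) auto
    also have "\<dots> = (\<Sum>b\<in>B. \<bar>?r b\<bar>) * (\<Sum>b\<in>B. norm (G s b - b))"
      by (simp add: sum_distrib_right)
    also have "\<dots> \<le> (c * norm x) * (\<Sum>b\<in>B. norm (G s b - b))"
      using c(1)[of ?r] by (intro mult_right_mono) (simp_all add: x sum_nonneg)
    finally show ?thesis by (simp add: \<eta>_def mult_ac)
  qed
  have "\<forall>\<^sub>F s in \<F>. \<eta> s < 1 / 2" using order_tendstoD(2)[OF \<eta>, of "1 / 2"] by simp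
  then have "\<forall>\<^sub>F s in \<F>. norm (u s - v s) \<le> \<eta> s * (2 * norm (v s))"
    using u G(2)
  proof eventually_elim
    case (elim s)
    have 1: "norm (u s - v s) \<le> \<eta> s * norm (u s)"
      using close[OF elim(3), of "u s"] elim(2) by (simp add: norm_minus_commute)
    have "\<eta> s \<ge> 0" using c(2) by (simp add: \<eta>_def sum_nonneg)
    have "norm (u s) \<le> norm (v s) + norm (u s - v s)"
      using norm_triangle_sub[of "u s" "v s"] .
    also have "\<dots> \<le> norm (v s) + (1 / 2) * norm (u s)"
      using 1 mult_right_mono[OF less_imp_le[OF elim(1)] norm_ge_zero[of "u s"]] by linarith
    finally have "norm (u s) \<le> 2 * norm (v s)" by simp
    from mult_left_mono[OF this \<open>\<eta> s \<ge> 0\<close>] 1 show ?case by linarith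
  qed
  moreover have "((\<lambda>s. \<eta> s * (2 * norm (v s))) \<longlongrightarrow> 0) \<F>"
    using tendsto_mult[OF \<eta> tendsto_mult[OF tendsto_const tendsto_norm[OF v]]] by simp
  ultimately have "((\<lambda>s. u s - v s) \<longlongrightarrow> 0) \<F>"
    by (rule Lim_null_comparison)
  then have "((\<lambda>s. (u s - v s) + v s) \<longlongrightarrow> 0 + l) \<F>"
    by (intro tendsto_add v)
  then show ?thesis by simp
qed

lemma eventually_in_open:
  assumes "(f has_derivative f') (at x)" "open S" "f x \<in> S"
  shows "\<forall>\<^sub>F t in nhds x. f t \<in> S"
proof -
  have "(f \<longlongrightarrow> f x) (nhds x)"
    using has_derivative_continuous[OF assms(1)]
    by (simp add: continuous_at tendsto_at_iff_tendsto_nhds)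
  then show ?thesis using assms(2,3) by (rule topological_tendstoD)
qed

lemma has_derivative_eventually_unique:
  assumes "(f has_derivative f') (at x)" "(g has_derivative g') (at x)"
    and "\<forall>\<^sub>F t in nhds x. f t = g t"
  shows "f' = g'"
proof -
  obtain S where S: "open S" "x \<in> S" "\<And>t. t \<in> S \<Longrightarrow> f t = g t"
    using assms(3) unfolding eventually_nhds by blast
  have "(g has_derivative f') (at x)"
    by (rule has_derivative_transform_within_open[OF assms(1) S(1,2)]) (rule S(3))
  then show ?thesis using assms(2) by (rule has_derivative_unique)
qed

lemma has_derivative_quotient_tendsto:
  fixes f :: "real \<Rightarrow> 'a::real_normed_vector"
  assumes "(f has_vector_derivative v) (at 0)" "f 0 = 0"
  shows "((\<lambda>s. f s /\<^sub>R s) \<longlongrightarrow> v) (at 0)"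
proof -
  have "((\<lambda>s. norm (f s - s *\<^sub>R v) / norm s) \<longlongrightarrow> 0) (at 0)"
    using assms unfolding has_vector_derivative_def has_derivative_iff_norm by simp
  moreover have "\<forall>\<^sub>F s in at (0::real). norm (f s - s *\<^sub>R v) / norm s = norm (f s /\<^sub>R s - v)"
  proof (rule eventually_mono[OF eventually_at_ball'[of 1]])
    fix s :: real assume "s \<in> ball 0 1 \<and> s \<noteq> 0 \<and> s \<in> UNIV"
    then have s: "s \<noteq> 0" by simp
    then have "f s /\<^sub>R s - v = (f s - s *\<^sub>R v) /\<^sub>R s" by (simp add: scaleR_diff_right)
    then show "norm (f s - s *\<^sub>R v) / norm s = norm (f s /\<^sub>R s - v)"
      by (simp add: divide_inverse mult.commute)
  qed simp
  ultimately have "((\<lambda>s. norm (f s /\<^sub>R s - v)) \<longlongrightarrow> 0) (at 0)"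
    by (rule Lim_transform_eventually)
  then have "((\<lambda>s. f s /\<^sub>R s - v) \<longlongrightarrow> 0) (at 0)" by (rule tendsto_norm_zero_cancel)
  then show ?thesis by (rule LIM_zero_cancel)
qed

section \<open>The Lie bracket in a chart\<close>

locale lie_group_chart =
  fixes G :: "('g::t2_space, 'z) monoid_scheme"
    and A :: "('g, 'a::real_normed_vector) chart set"
    and U :: "'g set" and \<phi> :: "'g \<Rightarrow> 'a"
  assumes lie: "lie_group G A" and chart: "(U, \<phi>) \<in> A" and one_in_U: "\<one>\<^bsub>G\<^esub> \<in> U"

sublocale lie_group_chart \<subseteq> group G
  using lie by (simp add: lie_group_def)

section \<open>Multiplication and inversion in chart coordinates\<close>

context lie_group_chart
begin

definition \<psi> :: "'a \<Rightarrow> 'g" where "\<psi> = inv_into U \<phi>"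

definition e :: 'a where "e = \<phi> \<one>\<^bsub>G\<^esub>"

definition mult_chart :: "'a \<times> 'a \<Rightarrow> 'a" where
  "mult_chart z = \<phi> (\<psi> (fst z) \<otimes>\<^bsub>G\<^esub> \<psi> (snd z))"

definition mult_dom :: "('a \<times> 'a) set" where
  "mult_dom = {z \<in> \<phi> ` U \<times> \<phi> ` U. \<psi> (fst z) \<otimes>\<^bsub>G\<^esub> \<psi> (snd z) \<in> U}"

definition inv_chart :: "'a \<Rightarrow> 'a" where
  "inv_chart p = \<phi> (inv\<^bsub>G\<^esub> \<psi> p)"

definition inv_dom :: "'a set" where
  "inv_dom = {p \<in> \<phi> ` U. inv\<^bsub>G\<^esub> \<psi> p \<in> U}"

lemma chart_on_U: "chart_on (carrier G) (U, \<phi>)"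
  using lie chart by (auto simp: lie_group_def smooth_manifold_def smooth_atlas_def)

lemma open_image: "open (\<phi> ` U)" and openin_U: "openin (top_of_set (carrier G)) U"
  using chart_on_U by (auto simp: chart_on_def)

lemma U_carrier: "x \<in> U \<Longrightarrow> x \<in> carrier G"
  using openin_imp_subset[OF openin_U] by auto

lemma \<psi>_\<phi>: "x \<in> U \<Longrightarrow> \<psi> (\<phi> x) = x" and continuous_\<psi>: "continuous_on (\<phi> ` U) \<psi>"
proof -
  obtain h where h: "homeomorphism U (\<phi> ` U) \<phi> h"
    using chart_on_U by (auto simp: chart_on_def)
  then have inj: "inj_on \<phi> U"
    by (metis homeomorphism_def inj_on_inverseI)
  then show *: "x \<in> U \<Longrightarrow> \<psi> (\<phi> x) = x" for x
    by (simp add: \<psi>_def)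
  have "h p = \<psi> p" if "p \<in> \<phi> ` U" for p
    using that h * by (auto simp: homeomorphism_def)
  then show "continuous_on (\<phi> ` U) \<psi>"
    using h unfolding homeomorphism_def by (simp cong: continuous_on_cong)
qed

lemma \<psi>_in_U: "p \<in> \<phi> ` U \<Longrightarrow> \<psi> p \<in> U" and \<phi>_\<psi>: "p \<in> \<phi> ` U \<Longrightarrow> \<phi> (\<psi> p) = p"
  by (auto simp: \<psi>_\<phi>)

lemma \<psi>_carrier: "p \<in> \<phi> ` U \<Longrightarrow> \<psi> p \<in> carrier G"
  by (simp add: \<psi>_in_U U_carrier)

lemma e_in: "e \<in> \<phi> ` U" and \<psi>_e: "\<psi> e = \<one>\<^bsub>G\<^esub>"
  using one_in_U by (simp_all add: e_def \<psi>_\<phi>)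

lemma open_mult_dom: "open mult_dom"
proof -
  obtain T where T: "open T" "\<And>x. x \<in> U \<longleftrightarrow> x \<in> carrier G \<and> x \<in> T"
    using openin_U unfolding openin_open by blast
  have "continuous_on (carrier G \<times> carrier G) (\<lambda>(x, y). x \<otimes>\<^bsub>G\<^esub> y)"
    using lie by (simp add: lie_group_def smooth_map_def)
  moreover have "continuous_on (\<phi> ` U \<times> \<phi> ` U) (\<lambda>z. (\<psi> (fst z), \<psi> (snd z)))"
    by (intro continuous_intros continuous_on_compose2[OF continuous_\<psi>]) auto
  ultimately have "continuous_on (\<phi> ` U \<times> \<phi> ` U) (\<lambda>z. \<psi> (fst z) \<otimes>\<^bsub>G\<^esub> \<psi> (snd z))"
    using continuous_on_compose2[of "carrier G \<times> carrier G" "\<lambda>(x, y). x \<otimes>\<^bsub>G\<^esub> y"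
        "\<phi> ` U \<times> \<phi> ` U" "\<lambda>z. (\<psi> (fst z), \<psi> (snd z))"] \<psi>_carrier
    by (force simp: image_subset_iff)
  then have "open ((\<phi> ` U \<times> \<phi> ` U) \<inter> (\<lambda>z. \<psi> (fst z) \<otimes>\<^bsub>G\<^esub> \<psi> (snd z)) -` T)"
    by (rule continuous_open_preimage) (use open_image T in \<open>auto intro: open_Times\<close>)
  moreover have "(\<phi> ` U \<times> \<phi> ` U) \<inter> (\<lambda>z. \<psi> (fst z) \<otimes>\<^bsub>G\<^esub> \<psi> (snd z)) -` T = mult_dom"
    using T(2) \<psi>_carrier by (fastforce simp: mult_dom_def simp del: image_iff)
  ultimately show ?thesis by simp
qed

lemma open_inv_dom: "open inv_dom"
proof -
  obtain T where T: "open T" "\<And>x. x \<in> U \<longleftrightarrow> x \<in> carrier G \<and> x \<in> T"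
    using openin_U unfolding openin_open by blast
  have "continuous_on (carrier G) (\<lambda>x. inv\<^bsub>G\<^esub> x)"
    using lie by (simp add: lie_group_def smooth_map_def)
  then have "continuous_on (\<phi> ` U) (\<lambda>p. inv\<^bsub>G\<^esub> \<psi> p)"
    by (rule continuous_on_compose2[OF _ continuous_\<psi>]) (use \<psi>_carrier in auto)
  then have "open (\<phi> ` U \<inter> (\<lambda>p. inv\<^bsub>G\<^esub> \<psi> p) -` T)"
    by (rule continuous_open_preimage) (use open_image T in auto)
  moreover have "\<phi> ` U \<inter> (\<lambda>p. inv\<^bsub>G\<^esub> \<psi> p) -` T = inv_dom"
    using T(2) \<psi>_carrier by (fastforce simp: inv_dom_def simp del: image_iff)
  ultimately show ?thesis by simp
qed

lemma differentiable_inv_chart: "p \<in> inv_dom \<Longrightarrow> inv_chart differentiable (at p)"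
proof -
  assume p: "p \<in> inv_dom"
  have "smooth_on (\<phi> \<circ> (\<lambda>x. inv\<^bsub>G\<^esub> x) \<circ> inv_into U \<phi>) (\<phi> ` (U \<inter> (\<lambda>x. inv\<^bsub>G\<^esub> x) -` U))"
    using lie chart by (auto simp: lie_group_def smooth_map_def)
  then have "Ck_on (Suc 0) (\<phi> \<circ> (\<lambda>x. inv\<^bsub>G\<^esub> x) \<circ> inv_into U \<phi>)
      (\<phi> ` (U \<inter> (\<lambda>x. inv\<^bsub>G\<^esub> x) -` U))"
    unfolding smooth_on_def by blast
  moreover have "p \<in> \<phi> ` (U \<inter> (\<lambda>x. inv\<^bsub>G\<^esub> x) -` U)"
    using p by (auto simp: inv_dom_def \<psi>_\<phi>)
  ultimately show ?thesis
    unfolding inv_chart_def[abs_def] \<psi>_def differentiable_def by (auto simp: o_def)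
qed

text \<open>Smoothness of the group law is given in the product chart, through
  \<open>inv_into\<close> of \<open>map_prod \<phi> \<phi>\<close>. On the open set
  \<open>mult_dom\<close> this inverse is the pair of inverses \<psi>, so the derivatives transfer
  to \<open>mult_chart\<close>.\<close>

lemma mult_chart_derivatives:
  obtains m' m'' where "\<And>z. z \<in> mult_dom \<Longrightarrow> (mult_chart has_derivative m' z) (at z)"
    and "\<And>u z. z \<in> mult_dom \<Longrightarrow> ((\<lambda>z. m' z u) has_derivative m'' u z) (at z)"
    and "\<And>u v. continuous_on mult_dom (\<lambda>z. m'' u z v)"
proof -
  let ?mult = "\<lambda>(x, y). x \<otimes>\<^bsub>G\<^esub> y"
  let ?f = "\<phi> \<circ> ?mult \<circ> inv_into (U \<times> U) (map_prod \<phi> \<phi>)"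
  have "(U \<times> U, map_prod \<phi> \<phi>) \<in> prod_atlas A A"
    using chart by (auto simp: prod_atlas_def)
  then have "smooth_on ?f (map_prod \<phi> \<phi> ` ((U \<times> U) \<inter> ?mult -` U))"
    using lie chart by (fastforce simp: lie_group_def smooth_map_def)
  moreover have "map_prod \<phi> \<phi> ` ((U \<times> U) \<inter> ?mult -` U) = mult_dom"
    by (force simp: mult_dom_def \<psi>_\<phi> image_iff)
  ultimately have "smooth_on ?f mult_dom" by simp
  then obtain m' m'' where m: "\<And>z. z \<in> mult_dom \<Longrightarrow> (?f has_derivative m' z) (at z)"
    "\<And>u z. z \<in> mult_dom \<Longrightarrow> ((\<lambda>z. m' z u) has_derivative m'' u z) (at z)"
    "\<And>u v. continuous_on mult_dom (\<lambda>z. m'' u z v)"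
    using smooth_on_second_derivatives by blast
  have "inj_on \<phi> U" using \<psi>_\<phi> by (metis inj_on_inverseI)
  then have inj: "inj_on (map_prod \<phi> \<phi>) (U \<times> U)" by (simp add: map_prod_inj_on)
  have eq: "?f z = mult_chart z" if "z \<in> mult_dom" for z
  proof -
    have z: "z = map_prod \<phi> \<phi> (\<psi> (fst z), \<psi> (snd z))" "(\<psi> (fst z), \<psi> (snd z)) \<in> U \<times> U"
      using that by (auto simp: mult_dom_def \<psi>_\<phi>)
    have "inv_into (U \<times> U) (map_prod \<phi> \<phi>) z = (\<psi> (fst z), \<psi> (snd z))"
      using inv_into_f_f[OF inj z(2)] z(1) by simp
    then show ?thesis by (simp add: mult_chart_def)
  qed
  have "(mult_chart has_derivative m' z) (at z)" if z: "z \<in> mult_dom" for z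
    by (rule has_derivative_transform_within_open[OF m(1)[OF z] open_mult_dom z]) (rule eq)
  then show ?thesis using that m(2,3) by blast
qed

lemma mult_dom_e: "p \<in> \<phi> ` U \<Longrightarrow> (p, e) \<in> mult_dom" "p \<in> \<phi> ` U \<Longrightarrow> (e, p) \<in> mult_dom"
  using e_in \<psi>_carrier \<psi>_in_U by (auto simp: mult_dom_def \<psi>_e)

lemma mult_chart_e: "p \<in> \<phi> ` U \<Longrightarrow> mult_chart (p, e) = p" "p \<in> \<phi> ` U \<Longrightarrow> mult_chart (e, p) = p"
  using \<psi>_carrier \<phi>_\<psi> by (simp_all add: mult_chart_def \<psi>_e)

lemma mult_chart_in: "z \<in> mult_dom \<Longrightarrow> mult_chart z \<in> \<phi> ` U"
  and \<psi>_mult_chart: "z \<in> mult_dom \<Longrightarrow> \<psi> (mult_chart z) = \<psi> (fst z) \<otimes>\<^bsub>G\<^esub> \<psi> (snd z)"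
  by (auto simp: mult_dom_def mult_chart_def \<psi>_\<phi>)

lemma inv_chart_in: "p \<in> inv_dom \<Longrightarrow> inv_chart p \<in> \<phi> ` U"
  and \<psi>_inv_chart: "p \<in> inv_dom \<Longrightarrow> \<psi> (inv_chart p) = inv\<^bsub>G\<^esub> \<psi> p"
  by (auto simp: inv_dom_def inv_chart_def \<psi>_\<phi>)

lemma e_inv_dom: "e \<in> inv_dom" and inv_chart_e: "inv_chart e = e"
  using e_in one_in_U by (simp_all add: inv_dom_def inv_chart_def \<psi>_e) (simp add: e_def)

section \<open>First and second derivatives of the group law\<close>

definition m' :: "'a \<times> 'a \<Rightarrow> 'a \<times> 'a \<Rightarrow> 'a" where
  "m' z = frechet_derivative mult_chart (at z)"

text \<open>In \<open>m'' u z v\<close> the direction \<open>u\<close> of the first differentiation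
  comes before the base point, and the direction \<open>v\<close> of the second comes last.\<close>

definition m'' :: "'a \<times> 'a \<Rightarrow> 'a \<times> 'a \<Rightarrow> 'a \<times> 'a \<Rightarrow> 'a" where
  "m'' u z = frechet_derivative (\<lambda>z. m' z u) (at z)"

lemma m': "z \<in> mult_dom \<Longrightarrow> (mult_chart has_derivative m' z) (at z)"
  and m'': "z \<in> mult_dom \<Longrightarrow> ((\<lambda>z. m' z u) has_derivative m'' u z) (at z)"
  and continuous_m'': "continuous_on mult_dom (\<lambda>z. m'' u z v)"
proof -
  obtain n' n'' where n: "\<And>z. z \<in> mult_dom \<Longrightarrow> (mult_chart has_derivative n' z) (at z)"
    "\<And>u z. z \<in> mult_dom \<Longrightarrow> ((\<lambda>z. n' z u) has_derivative n'' u z) (at z)"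
    "\<And>u v. continuous_on mult_dom (\<lambda>z. n'' u z v)"
    using mult_chart_derivatives by blast
  have m'_eq: "m' z = n' z" if "z \<in> mult_dom" for z
    using frechet_derivative_at[OF n(1)[OF that]] by (simp add: m'_def)
  have d: "((\<lambda>z. m' z u) has_derivative n'' u z) (at z)" if "z \<in> mult_dom" for z u
    by (rule has_derivative_transform_within_open[OF n(2)[OF that] open_mult_dom that])
      (simp add: m'_eq)
  have m''_eq: "m'' u z = n'' u z" if "z \<in> mult_dom" for z u
    using frechet_derivative_at[OF d[OF that]] by (simp add: m''_def)
  show "z \<in> mult_dom \<Longrightarrow> (mult_chart has_derivative m' z) (at z)" for z
    using n(1) by (simp add: m'_eq)
  show "z \<in> mult_dom \<Longrightarrow> ((\<lambda>z. m' z u) has_derivative m'' u z) (at z)" for z u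
    using d by (simp add: m''_eq)
  show "continuous_on mult_dom (\<lambda>z. m'' u z v)" for u v
    using n(3)[of u v] by (simp add: m''_eq cong: continuous_on_cong)
qed

lemma m''_symmetric: "z \<in> mult_dom \<Longrightarrow> m'' u z v = m'' v z u"
  by (rule second_derivative_symmetric[OF open_mult_dom _ m' m'' continuous_m''])

lemma linear_m': "z \<in> mult_dom \<Longrightarrow> linear (m' z)"
  and linear_m'': "z \<in> mult_dom \<Longrightarrow> linear (m'' u z)"
  using m' m'' has_derivative_linear by blast+

lemma partial_derivatives:
  assumes "(p, q) \<in> mult_dom"
  shows "((\<lambda>p. mult_chart (p, q)) has_derivative (\<lambda>v. m' (p, q) (v, 0))) (at p)"
    and "((\<lambda>q. mult_chart (p, q)) has_derivative (\<lambda>v. m' (p, q) (0, v))) (at q)"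
    and "((\<lambda>p. m' (p, q) u) has_derivative (\<lambda>v. m'' u (p, q) (v, 0))) (at p)"
    and "((\<lambda>q. m' (p, q) u) has_derivative (\<lambda>v. m'' u (p, q) (0, v))) (at q)"
proof -
  have 1: "((\<lambda>p. (p, q)) has_derivative (\<lambda>v. (v, 0))) (at p)"
    and 2: "((\<lambda>q. (p, q)) has_derivative (\<lambda>v. (0, v))) (at q)"
    by (auto intro!: derivative_eq_intros)
  show "((\<lambda>p. mult_chart (p, q)) has_derivative (\<lambda>v. m' (p, q) (v, 0))) (at p)"
    "((\<lambda>p. m' (p, q) u) has_derivative (\<lambda>v. m'' u (p, q) (v, 0))) (at p)"
    using has_derivative_compose[OF 1] m'[OF assms] m''[OF assms] by blast+
  show "((\<lambda>q. mult_chart (p, q)) has_derivative (\<lambda>v. m' (p, q) (0, v))) (at q)"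
    "((\<lambda>q. m' (p, q) u) has_derivative (\<lambda>v. m'' u (p, q) (0, v))) (at q)"
    using has_derivative_compose[OF 2] m'[OF assms] m''[OF assms] by blast+
qed

lemma m'_e: "p \<in> \<phi> ` U \<Longrightarrow> m' (p, e) (v, 0) = v" "p \<in> \<phi> ` U \<Longrightarrow> m' (e, p) (0, v) = v"
proof -
  assume p: "p \<in> \<phi> ` U"
  have id: "((\<lambda>p. p) has_derivative (\<lambda>v. v)) (at p)" by (rule has_derivative_ident)
  have "((\<lambda>p. mult_chart (p, e)) has_derivative (\<lambda>v. v)) (at p)"
    by (rule has_derivative_transform_within_open[OF id open_image p]) (simp add: mult_chart_e)
  then show "m' (p, e) (v, 0) = v"
    using has_derivative_unique[OF _ partial_derivatives(1)[OF mult_dom_e(1)[OF p]]] by metis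
  have "((\<lambda>p. mult_chart (e, p)) has_derivative (\<lambda>v. v)) (at p)"
    by (rule has_derivative_transform_within_open[OF id open_image p]) (simp add: mult_chart_e)
  then show "m' (e, p) (0, v) = v"
    using has_derivative_unique[OF _ partial_derivatives(2)[OF mult_dom_e(2)[OF p]]] by metis
qed

section \<open>The bracket as a second derivative of the group law\<close>

abbreviation br :: "'a \<Rightarrow> 'a \<Rightarrow> 'a" where
  "br \<equiv> lie_bracket G (U, \<phi>)"

lemma left_inv_field_eq: "p \<in> \<phi> ` U \<Longrightarrow> left_inv_field G (U, \<phi>) X p = m' (p, e) (0, X)"
  using frechet_derivative_at[OF partial_derivatives(2)[OF mult_dom_e(1)], of p]
  by (simp add: left_inv_field_def mult_chart_def \<psi>_def flip: e_def) metis

lemma lie_bracket_eq: "br X Y = m'' (0, Y) (e, e) (X, 0) - m'' (0, X) (e, e) (Y, 0)"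
proof -
  have "frechet_derivative (left_inv_field G (U, \<phi>) Y) (at e) = (\<lambda>v. m'' (0, Y) (e, e) (v, 0))" for Y
    by (rule frechet_derivative_at[symmetric],
        rule has_derivative_transform_within_open[OF partial_derivatives(3)[OF mult_dom_e(1)[OF e_in]]
          open_image e_in])
      (simp add: left_inv_field_eq)
  then show ?thesis by (simp add: lie_bracket_def flip: e_def)
qed

text \<open>A second derivative is linear in its last direction by construction; symmetry of
  \<open>m''\<close> moves the other direction into that slot.\<close>

lemma bilinear_lie_bracket: "bilinear br"
proof -
  note ee = mult_dom_e(1)[OF e_in]
  have lin: "linear (\<lambda>v. m'' u (e, e) (v, 0))" "linear (\<lambda>v. m'' u (e, e) (0, v))" for u
    using linear_m''[OF ee, of u]
    by (auto intro!: linearI simp: linear_iff simp flip: add_Pair scaleR_Pair)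
      (metis add_Pair scaleR_Pair add_0 scaleR_zero_right)+
  have sym: "m'' (0, Y) (e, e) (X, 0) = m'' (X, 0) (e, e) (0, Y)" for X Y
    by (rule m''_symmetric[OF ee])
  have "linear (\<lambda>X. br X Y)" for Y
    unfolding lie_bracket_eq
    by (subst (2) sym) (intro linear_compose_sub lin)
  moreover have "linear (br X)" for X
    unfolding lie_bracket_eq[abs_def]
    by (subst (1) sym) (intro linear_compose_sub lin)
  ultimately show ?thesis by (simp add: bilinear_def)
qed

lemma lie_bracket_antisym: "br X Y = - br Y X"
  by (simp add: lie_bracket_def)

end

section \<open>Nilpotency of the Lie algebra of a nilpotent Lie group\<close>

context lie_group_chart
begin

text \<open>The curves only have to be differentiable at 0 and to stay in the subgroup for small
  \<open>t\<close>, so no manifold structure on the terms of the lower central series is involved.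
  The spans of these sets form the filtration of the Lie algebra.\<close>

definition tangent :: "nat \<Rightarrow> 'a set" where
  "tangent k = {Y. \<exists>\<gamma>. \<gamma> 0 = e \<and> (\<gamma> has_vector_derivative Y) (at 0) \<and>
     (\<forall>\<^sub>F t in nhds (0::real). \<gamma> t \<in> \<phi> ` U \<and> \<psi> (\<gamma> t) \<in> lower_central G k)}"

lemma tangent_0: "tangent 0 = UNIV"
proof -
  have "Y \<in> tangent 0" for Y
  proof -
    let ?\<gamma> = "\<lambda>t. e + t *\<^sub>R Y"
    have d: "(?\<gamma> has_derivative (\<lambda>h. h *\<^sub>R Y)) (at 0)"
      by (auto intro!: derivative_eq_intros)
    have "\<forall>\<^sub>F t in nhds 0. ?\<gamma> t \<in> \<phi> ` U"
      by (rule eventually_in_open[OF d open_image]) (simp add: e_in)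
    then have "\<forall>\<^sub>F t in nhds 0. ?\<gamma> t \<in> \<phi> ` U \<and> \<psi> (?\<gamma> t) \<in> lower_central G 0"
      by eventually_elim (simp add: \<psi>_carrier)
    then show ?thesis
      using d unfolding tangent_def has_vector_derivative_def mem_Collect_eq
      by (intro exI[of _ ?\<gamma>] conjI) simp_all
  qed
  then show ?thesis by blast
qed

lemma tangent_trivial:
  assumes "lower_central G n = {\<one>\<^bsub>G\<^esub>}"
  shows "tangent n \<subseteq> {0}"
proof
  fix Y assume "Y \<in> tangent n"
  then obtain \<gamma> where \<gamma>: "(\<gamma> has_derivative (\<lambda>h. h *\<^sub>R Y)) (at 0)"
      "\<forall>\<^sub>F t in nhds (0::real). \<gamma> t \<in> \<phi> ` U \<and> \<psi> (\<gamma> t) \<in> lower_central G n"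
    by (auto simp: tangent_def has_vector_derivative_def)
  from \<gamma>(2) have "\<forall>\<^sub>F t in nhds 0. \<gamma> t = e"
    by eventually_elim (metis \<phi>_\<psi> assms e_def singletonD)
  then have "(\<lambda>h. h *\<^sub>R Y) = (\<lambda>h. 0)"
    using has_derivative_eventually_unique[OF \<gamma>(1) has_derivative_const] by blast
  from fun_cong[OF this, of 1] show "Y \<in> {0}" by simp
qed

text \<open>The curve is the commutator of \<open>\<psi> p\<close> with
  \<open>\<psi> (\<gamma> t)\<close>. Its velocity \<open>w\<close> is found from the relation that
  commutator times \<gamma> \<open>p\<close> equals \<open>p\<close> \<gamma>, differentiated at 0.
  The derivative \<open>i'\<close> of inversion shows only that the curve is differentiable and
  drops out of the formula.\<close>

lemma commutator_curve:
  assumes p: "p \<in> inv_dom" and Y: "Y \<in> tangent k"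
  shows "\<exists>w\<in>tangent (Suc k). m' (e, p) (w, 0) = m' (p, e) (0, Y) - m' (e, p) (Y, 0)"
proof -
  obtain \<gamma> where \<gamma>: "\<gamma> 0 = e" "(\<gamma> has_derivative (\<lambda>h. h *\<^sub>R Y)) (at 0)"
      "\<forall>\<^sub>F t in nhds (0::real). \<gamma> t \<in> \<phi> ` U \<and> \<psi> (\<gamma> t) \<in> lower_central G k"
    using Y by (auto simp: tangent_def has_vector_derivative_def)
  have pU: "p \<in> \<phi> ` U" using p by (simp add: inv_dom_def)
  define p' where "p' = inv_chart p"
  have p'U: "p' \<in> \<phi> ` U" unfolding p'_def by (rule inv_chart_in[OF p])
  have \<psi>p': "\<psi> p' = inv\<^bsub>G\<^esub> \<psi> p" unfolding p'_def by (rule \<psi>_inv_chart[OF p])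
  have pp': "(p, p') \<in> mult_dom" "mult_chart (p, p') = e"
    using pU p'U \<psi>_carrier[OF pU] one_in_U
    by (simp_all add: mult_dom_def mult_chart_def \<psi>p' r_inv e_def)
  obtain i' where i': "(inv_chart has_derivative i') (at e)"
    using differentiable_inv_chart[OF e_inv_dom] unfolding differentiable_def by blast
  have d_i: "((\<lambda>t. inv_chart (\<gamma> t)) has_derivative (\<lambda>h. i' (h *\<^sub>R Y))) (at 0)"
    by (rule has_derivative_compose[OF \<gamma>(2)]) (simp only: \<gamma>(1) i')
  have d_p\<gamma>: "((\<lambda>t. (p, \<gamma> t)) has_derivative (\<lambda>h. (0, h *\<^sub>R Y))) (at 0)"
    by (intro has_derivative_Pair has_derivative_const \<gamma>(2))
  have d_\<gamma>p: "((\<lambda>t. (\<gamma> t, p)) has_derivative (\<lambda>h. (h *\<^sub>R Y, 0))) (at 0)"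
    by (intro has_derivative_Pair has_derivative_const \<gamma>(2))
  have d_p'i: "((\<lambda>t. (p', inv_chart (\<gamma> t))) has_derivative (\<lambda>h. (0, i' (h *\<^sub>R Y)))) (at 0)"
    by (intro has_derivative_Pair has_derivative_const d_i)
  define f where "f t = mult_chart (p, \<gamma> t)" for t
  \<comment> \<open>Grouping the commutator as \<open>f t\<close> times \<open>g t\<close> keeps the
    partial products near \<open>p\<close>, its inverse \<open>p'\<close> and \<open>e\<close>,
    hence in the chart.\<close>
  define g where "g t = mult_chart (p', inv_chart (\<gamma> t))" for t
  define c where "c t = mult_chart (f t, g t)" for t
  define q where "q t = mult_chart (\<gamma> t, p)" for t
  have f: "f 0 = p" "(f has_derivative (\<lambda>h. m' (p, e) (0, h *\<^sub>R Y))) (at 0)"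
  proof -
    have "(mult_chart has_derivative m' (p, e)) (at (p, \<gamma> 0))"
      using m'[OF mult_dom_e(1)[OF pU]] by (simp only: \<gamma>(1))
    then show "(f has_derivative (\<lambda>h. m' (p, e) (0, h *\<^sub>R Y))) (at 0)"
      unfolding f_def[abs_def] by (rule has_derivative_compose[OF d_p\<gamma>])
  qed (simp add: f_def \<gamma>(1) mult_chart_e(1)[OF pU])
  have q: "q 0 = p" "(q has_derivative (\<lambda>h. m' (e, p) (h *\<^sub>R Y, 0))) (at 0)"
  proof -
    have "(mult_chart has_derivative m' (e, p)) (at (\<gamma> 0, p))"
      using m'[OF mult_dom_e(2)[OF pU]] by (simp only: \<gamma>(1))
    then show "(q has_derivative (\<lambda>h. m' (e, p) (h *\<^sub>R Y, 0))) (at 0)"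
      unfolding q_def[abs_def] by (rule has_derivative_compose[OF d_\<gamma>p])
  qed (simp add: q_def \<gamma>(1) mult_chart_e(2)[OF pU])
  have g: "g 0 = p'" "(g has_derivative (\<lambda>h. m' (p', e) (0, i' (h *\<^sub>R Y)))) (at 0)"
  proof -
    have "(mult_chart has_derivative m' (p', e)) (at (p', inv_chart (\<gamma> 0)))"
      using m'[OF mult_dom_e(1)[OF p'U]] by (simp only: \<gamma>(1) inv_chart_e)
    then show "(g has_derivative (\<lambda>h. m' (p', e) (0, i' (h *\<^sub>R Y)))) (at 0)"
      unfolding g_def[abs_def] by (rule has_derivative_compose[OF d_p'i])
  qed (simp add: g_def \<gamma>(1) inv_chart_e mult_chart_e(1)[OF p'U])
  note fg = has_derivative_Pair[OF f(2) g(2)]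
  obtain c' where c': "(c has_derivative c') (at 0)"
  proof -
    have "(mult_chart has_derivative m' (p, p')) (at (f 0, g 0))"
      using m'[OF pp'(1)] by (simp only: f(1) g(1))
    from has_derivative_compose[OF fg this] show ?thesis
      using that unfolding c_def[abs_def] by blast
  qed
  define w where "w = c' 1"
  have c'_eq: "c' = (\<lambda>h. h *\<^sub>R w)"
  proof
    show "c' h = h *\<^sub>R w" for h
      using linear_scale[OF has_derivative_linear[OF c'], of h 1]
      by (simp only: w_def real_scaleR_def mult_1_right)
  qed
  have c0: "c 0 = e" by (simp add: c_def f g pp')
  have ev: "\<forall>\<^sub>F t in nhds 0. (\<gamma> t \<in> \<phi> ` U \<and> \<psi> (\<gamma> t) \<in> lower_central G k) \<and> \<gamma> t \<in> inv_dom \<and>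
      (p, \<gamma> t) \<in> mult_dom \<and> (\<gamma> t, p) \<in> mult_dom \<and> (p', inv_chart (\<gamma> t)) \<in> mult_dom \<and>
      (f t, g t) \<in> mult_dom"
    by (intro eventually_conj \<gamma>(3) eventually_in_open[OF \<gamma>(2) open_inv_dom]
        eventually_in_open[OF d_p\<gamma> open_mult_dom] eventually_in_open[OF d_\<gamma>p open_mult_dom]
        eventually_in_open[OF d_p'i open_mult_dom] eventually_in_open[OF fg open_mult_dom])
      (simp_all add: \<gamma>(1) f(1) g(1) e_inv_dom inv_chart_e mult_dom_e pU p'U pp')
  have "\<forall>\<^sub>F t in nhds 0. (c t \<in> \<phi> ` U \<and> \<psi> (c t) \<in> lower_central G (Suc k)) \<and>
      mult_chart (c t, q t) = f t"
    using ev
  proof (rule eventually_mono)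
    fix t
    assume t: "(\<gamma> t \<in> \<phi> ` U \<and> \<psi> (\<gamma> t) \<in> lower_central G k) \<and> \<gamma> t \<in> inv_dom \<and>
      (p, \<gamma> t) \<in> mult_dom \<and> (\<gamma> t, p) \<in> mult_dom \<and> (p', inv_chart (\<gamma> t)) \<in> mult_dom \<and>
      (f t, g t) \<in> mult_dom"
    let ?x = "\<psi> p" and ?y = "\<psi> (\<gamma> t)"
    have xy: "?x \<in> carrier G" "?y \<in> carrier G" using t \<psi>_carrier pU by auto
    have "\<psi> (f t) = ?x \<otimes>\<^bsub>G\<^esub> ?y" "\<psi> (g t) = inv\<^bsub>G\<^esub> ?x \<otimes>\<^bsub>G\<^esub> inv\<^bsub>G\<^esub> ?y"
      "\<psi> (q t) = ?y \<otimes>\<^bsub>G\<^esub> ?x"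
      using t by (simp_all add: f_def g_def q_def \<psi>_mult_chart \<psi>p' \<psi>_inv_chart)
    moreover have "\<psi> (c t) = \<psi> (f t) \<otimes>\<^bsub>G\<^esub> \<psi> (g t)"
      using t by (simp add: c_def \<psi>_mult_chart)
    ultimately have \<psi>c: "\<psi> (c t) = ?x \<otimes>\<^bsub>G\<^esub> ?y \<otimes>\<^bsub>G\<^esub> inv\<^bsub>G\<^esub> ?x \<otimes>\<^bsub>G\<^esub> inv\<^bsub>G\<^esub> ?y"
      and \<psi>q: "\<psi> (q t) = ?y \<otimes>\<^bsub>G\<^esub> ?x"
      using xy by (simp_all add: m_assoc)
    have "c t \<in> \<phi> ` U" using t by (simp add: c_def mult_chart_in)
    moreover have "\<psi> (c t) \<in> lower_central G (Suc k)"
      unfolding \<psi>c lower_central.simps using xy(1) t by (intro generate.incl) blast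
    moreover
    have "inv\<^bsub>G\<^esub> ?y \<otimes>\<^bsub>G\<^esub> (?y \<otimes>\<^bsub>G\<^esub> ?x) = ?x"
      using xy by (simp flip: m_assoc)
    then have "\<psi> (c t) \<otimes>\<^bsub>G\<^esub> \<psi> (q t) = ?x \<otimes>\<^bsub>G\<^esub> ?y"
      using xy by (simp add: \<psi>c \<psi>q m_assoc)
    then have "mult_chart (c t, q t) = f t"
      by (simp add: mult_chart_def f_def)
    ultimately show "(c t \<in> \<phi> ` U \<and> \<psi> (c t) \<in> lower_central G (Suc k)) \<and>
      mult_chart (c t, q t) = f t" by blast
  qed
  then have curve: "\<forall>\<^sub>F t in nhds 0. c t \<in> \<phi> ` U \<and> \<psi> (c t) \<in> lower_central G (Suc k)"
    and rel: "\<forall>\<^sub>F t in nhds 0. mult_chart (c t, q t) = f t"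
    unfolding eventually_conj_iff by blast+
  have "w \<in> tangent (Suc k)"
    unfolding tangent_def mem_Collect_eq
    using c0 c'[unfolded c'_eq, folded has_vector_derivative_def] curve
    by (intro exI[of _ c] conjI)
  moreover have "m' (e, p) (w, 0) = m' (p, e) (0, Y) - m' (e, p) (Y, 0)"
  proof -
    have "((\<lambda>t. mult_chart (c t, q t)) has_derivative
        (\<lambda>h. m' (e, p) (h *\<^sub>R w, m' (e, p) (h *\<^sub>R Y, 0)))) (at 0)"
    proof -
      have "(mult_chart has_derivative m' (e, p)) (at (c 0, q 0))"
        using m'[OF mult_dom_e(2)[OF pU]] by (simp only: c0 q(1))
      from has_derivative_compose[OF has_derivative_Pair[OF c' q(2)] this] show ?thesis
        unfolding c'_eq .
    qed
    from has_derivative_eventually_unique[OF this f(2) rel]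
    have "m' (e, p) (1 *\<^sub>R w, m' (e, p) (1 *\<^sub>R Y, 0)) = m' (p, e) (0, 1 *\<^sub>R Y)"
      by (rule fun_cong)
    moreover have "m' (e, p) (w, m' (e, p) (Y, 0)) = m' (e, p) (w, 0) + m' (e, p) (Y, 0)"
      using linear_add[OF linear_m'[OF mult_dom_e(2)[OF pU]], of "(w, 0)" "(0, m' (e, p) (Y, 0))"]
        m'_e(2)[OF pU] by simp
    ultimately show ?thesis by (simp add: algebra_simps)
  qed
  ultimately show ?thesis by blast
qed

text \<open>Along \<open>p = e + s X\<close> the velocities \<open>w\<close> of the commutator curves satisfy \<open>w / s \<longlonglongrightarrow> [X, Y]\<close>.\<close>

lemma lie_bracket_tangent:
  assumes fin: "finite (F :: 'a set)" "span F = UNIV" and Y: "Y \<in> span (tangent k)"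
  shows "br X Y \<in> span (tangent (Suc k))"
proof -
  have step: "br X Y \<in> span (tangent (Suc k))" if Y: "Y \<in> tangent k" for Y
  proof -
    obtain B :: "'a set" where B: "independent B" "span B = UNIV"
      by (rule real_vector.maximal_independent_subset[of UNIV]) auto
    have finB: "finite B" using real_vector.independent_span_bound[OF fin(1) B(1)] fin(2) by simp
    define p where "p s = e + s *\<^sub>R X" for s :: real
    have p: "(p has_derivative (\<lambda>h. h *\<^sub>R X)) (at 0)" "p 0 = e"
      unfolding p_def by (auto intro!: derivative_eq_intros)
    define f where "f s = m' (p s, e) (0, Y) - m' (e, p s) (Y, 0)" for s
    note ee = mult_dom_e(1)[OF e_in]
    have "((\<lambda>s. m' (p s, e) (0, Y)) has_derivative (\<lambda>h. m'' (0, Y) (e, e) (h *\<^sub>R X, 0))) (at 0)"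
      by (rule has_derivative_compose[OF p(1), of "\<lambda>p. m' (p, e) (0, Y)"])
        (simp only: p(2) partial_derivatives(3)[OF ee])
    moreover have d2: "((\<lambda>s. m' (e, p s) (b, 0)) has_derivative (\<lambda>h. m'' (b, 0) (e, e) (0, h *\<^sub>R X))) (at 0)"
      for b
      by (rule has_derivative_compose[OF p(1), of "\<lambda>p. m' (e, p) (b, 0)"])
        (simp only: p(2) partial_derivatives(4)[OF ee])
    ultimately have "(f has_derivative (\<lambda>h. m'' (0, Y) (e, e) (h *\<^sub>R X, 0) -
        m'' (Y, 0) (e, e) (0, h *\<^sub>R X))) (at 0)"
      unfolding f_def by (intro has_derivative_diff)
    \<comment> \<open>Symmetry of \<open>m''\<close> turns the second term into the one occurring in
      \<open>lie_bracket_eq\<close>.\<close>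
    moreover have "m'' (0, Y) (e, e) (h *\<^sub>R X, 0) - m'' (Y, 0) (e, e) (0, h *\<^sub>R X) = h *\<^sub>R br X Y" for h
      using linear_scale[OF linear_m''[OF ee, of "(0, Y)"], of h "(X, 0)"]
        linear_scale[OF linear_m''[OF ee, of "(Y, 0)"], of h "(0, X)"]
        m''_symmetric[OF ee, of "(Y, 0)" "(0, X)"]
      by (simp add: lie_bracket_eq scaleR_diff_right)
    ultimately have "(f has_vector_derivative br X Y) (at 0)"
      by (simp add: has_vector_derivative_def)
    moreover have "f 0 = 0" by (simp add: f_def p(2) m'_e e_in)
    ultimately have quot: "((\<lambda>s. f s /\<^sub>R s) \<longlongrightarrow> br X Y) (at 0)"
      by (rule has_derivative_quotient_tendsto)
    have "\<exists>w. p s \<in> inv_dom \<longrightarrow> w \<in> tangent (Suc k) \<and> m' (e, p s) (w, 0) = f s" for s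
      using commutator_curve[OF _ Y, of "p s"] unfolding f_def by blast
    then obtain w where
      w: "\<And>s. p s \<in> inv_dom \<longrightarrow> w s \<in> tangent (Suc k) \<and> m' (e, p s) (w s, 0) = f s"
      by metis
    have "\<forall>\<^sub>F s in nhds 0. p s \<in> inv_dom"
      by (rule eventually_in_open[OF p(1) open_inv_dom]) (simp only: p(2) e_inv_dom)
    then have ev: "\<forall>\<^sub>F s in at 0. p s \<in> inv_dom"
      by (simp add: eventually_at_filter eventually_mono)
    have lin: "linear (\<lambda>v. m' (e, p s) (v, 0))" if "p s \<in> inv_dom" for s
    proof -
      have "(e, p s) \<in> mult_dom" using that by (intro mult_dom_e) (simp add: inv_dom_def)
      from linear_compose[OF _ linear_m'[OF this], of "\<lambda>v. (v, 0)"] show ?thesis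
        by (simp add: o_def linear_iff)
    qed
    \<comment> \<open>The vector \<open>w s /\<^sub>R s\<close> solves a linear equation with right
      side \<open>f s /\<^sub>R s\<close>, and its operator tends to the identity because
      \<open>p s\<close> tends to \<open>e\<close>.\<close>
    have "((\<lambda>s. w s /\<^sub>R s) \<longlongrightarrow> br X Y) (at 0)"
    proof (rule tendsto_almost_identity[OF finB B _ _ _ quot])
      show "((\<lambda>s. m' (e, p s) (b, 0)) \<longlongrightarrow> b) (at 0)" for b
        using has_derivative_continuous[OF d2[of b]] m'_e(1)[OF e_in]
        by (simp add: continuous_at p(2))
      show "\<forall>\<^sub>F s in at 0. linear (\<lambda>v. m' (e, p s) (v, 0))"
        using ev by eventually_elim (rule lin)
      show "\<forall>\<^sub>F s in at 0. m' (e, p s) (w s /\<^sub>R s, 0) = f s /\<^sub>R s"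
        using ev by eventually_elim (use linear_scale[OF lin] w in simp)
    qed
    moreover have "\<forall>\<^sub>F s in at 0. w s /\<^sub>R s \<in> span (tangent (Suc k))"
      using ev by eventually_elim (use w in \<open>blast intro: span_scale span_base\<close>)
    \<comment> \<open>Finite dimension makes the span closed, so it contains the limit of the
      velocities.\<close>
    moreover have "closed (span (tangent (Suc k)))"
      using fin by (intro closed_subspace_finite_dim[of F]) auto
    ultimately show ?thesis
      by (intro Lim_in_closed_set[of _ "\<lambda>s. w s /\<^sub>R s" "at 0"]) auto
  qed
  have "tangent k \<subseteq> br X -` span (tangent (Suc k))" using step by blast
  moreover have "subspace (br X -` span (tangent (Suc k)))"
    using bilinear_lie_bracket by (intro linear_subspace_vimage) (auto simp: bilinear_def)
  ultimately have "span (tangent k) \<subseteq> br X -` span (tangent (Suc k))" by (rule span_minimal)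
  then show ?thesis using Y by blast
qed

end

theorem theorem1p17:
  fixes G :: "('g::t2_space, 'z) monoid_scheme"
    and A :: "('g, 'a::real_normed_vector) chart set"
    and \<Gamma> :: "'g set"
    and c :: "('g, 'a) chart"
    and I J K :: "'a \<Rightarrow> 'a"
  assumes "nilmanifold \<Gamma> G A"
    and "c \<in> A" and "\<one>\<^bsub>G\<^esub> \<in> fst c"
    and "hypercomplex_structure (lie_bracket G c) I J K"
    and "obata_flat (lie_bracket G c) I J K"
  shows "H_solvable (lie_bracket G c) I J K"
proof -
  obtain U \<phi> where c: "c = (U, \<phi>)" by (cases c)
  have "lie_group G A" using assms(1) by (simp only: nilmanifold_def)
  then interpret lie_group_chart G A U \<phi>
    using assms(2,3) unfolding c fst_conv by (rule lie_group_chart.intro)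
  obtain n where n: "lower_central G n = {\<one>\<^bsub>G\<^esub>}"
    using assms(1) by (auto simp: nilmanifold_def nilpotent_group_def)
  obtain F :: "'a set" where F: "finite F" "span F = UNIV"
    using lie by (auto simp: lie_group_def smooth_manifold_def)
  have "span (tangent n) = {0}"
    using tangent_trivial[OF n] span_mono[of "tangent n" "{0}"] span_0[of "tangent n"] by auto
  \<comment> \<open>The spans of velocities serve as the filtration: everything at index 0, zero at
    the nilpotency index \<open>n\<close> of the group, and shifted by one under each
    bracket.\<close>
  then have "flat_hypercomplex (lie_bracket G c) I J K (\<lambda>k. span (tangent k)) n F"
    unfolding c
    by (intro flat_hypercomplex.intro F bilinear_lie_bracket lie_bracket_antisym
        assms(4,5)[unfolded c] subspace_span lie_bracket_tangent[OF F])
      (simp_all only: tangent_0 span_UNIV)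
  then show ?thesis by (rule flat_hypercomplex.H_solvable)
qed

end
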